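(* Let $F$ be a field of characteristic zero, $k\ge2$, $L=\mathrm{sl}_k(F)$. Put $\lambda_{1,k}:=0$ and, for $2\le p\le k$, let $\lambda_{p,k}:=\chi_k(c_{p,k})$ be the eigenvalue of the Casimir element $c_{p,k}\in Z(U(L))$ for the adjoint representation of $L$. Then $\lambda_{2,k}=2k$ and $\lambda_{p,k}=\lambda_{p-2,k}+k^{p-1}$ for $3\le p\le k$; thus, for $2\leq p\leq k$, $$\lambda_{p,k}=\begin{cases}\displaystyle k\left(\frac{k^p-1}{k^2-1}+1\right), & p\text{ even},\\[3mm] \displaystyle k^2\,\frac{k^{p-1}-1}{k^2-1}, & p\text{ odd}.\end{cases}$$
   Context: $U(L)$ is the universal enveloping algebra of $L$ and $Z(U(L))$ its center. $e_{ij}$ are the matrix units and $h_i:=e_{ii}-e_{i+1,i+1}$, $1\le i<k$. Put $x^i_j:=e_{ij}$ for $i\ne j$, and $x^i_i:=\frac1k\sum_{j=1}^{k-1}\alpha_{ij}h_j$ with $\alpha_{ij}:=k-j$ if $j\ge i$ and $\alpha_{ij}:=-j$ if $j<i$. For $2\le p\le k$, $$c_{p,k}:=\sum_{i_1,\dots,i_p=1}^k x^{i_1}_{i_2}x^{i_2}_{i_3}\cdots x^{i_p}_{i_1}\in Z(U(L))$$ (product in $U(L)$). $\chi_k$ is the central character of the adjoint representation: $c\in Z(U(L))$ acts on $L$ (through the adjoint representation extended to $U(L)$) as the scalar $\chi_k(c)$. *)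

theory Defs
  imports
    Jordan_Normal_Form.Matrix
    "HOL-Algebra.QuotRing"
    "HOL-Library.Poly_Mapping"
begin

section \<open>Free associative algebras\<close>

text \<open>Lists under concatenation form the free monoid, so that the convolution product of
  \<^theory>\<open>HOL-Library.Poly_Mapping\<close> on finitely supported functions on lists is the product of
  noncommutative polynomials.\<close>

instantiation list :: (type) monoid_add
begin

definition zero_list_def: "0 = []"
definition plus_list_def: "xs + ys = xs @ ys"

instance
  by standard (simp_all add: zero_list_def plus_list_def)

end

definition free_algebra :: "'x set \<Rightarrow> ('x list \<Rightarrow>\<^sub>0 'f::field) ring" where
  "free_algebra S =
    \<lparr>carrier = {f. \<forall>w\<in>Poly_Mapping.keys f. set w \<subseteq> S},
     mult = (*), one = 1, zero = 0, add = (+)\<rparr>"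

definition gen :: "'x \<Rightarrow> ('x list \<Rightarrow>\<^sub>0 'f::field)" where
  "gen x = Poly_Mapping.single [x] 1"

definition const :: "'f \<Rightarrow> ('x list \<Rightarrow>\<^sub>0 'f::field)" where
  "const a = Poly_Mapping.single [] a"

lemma free_algebra_simps [simp]:
  "f \<in> carrier (free_algebra S) \<longleftrightarrow> (\<forall>w\<in>Poly_Mapping.keys f. set w \<subseteq> S)"
  "mult (free_algebra S) = (*)" "one (free_algebra S) = 1"
  "zero (free_algebra S) = 0" "add (free_algebra S) = (+)"
  by (simp_all add: free_algebra_def)

lemma ring_free_algebra: "ring (free_algebra S :: ('x list \<Rightarrow>\<^sub>0 'f::field) ring)"
proof (rule ringI)
  let ?R = "free_algebra S :: ('x list \<Rightarrow>\<^sub>0 'f) ring"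
  show "abelian_group ?R"
  proof (rule abelian_groupI)
    fix f g assume "f \<in> carrier ?R" "g \<in> carrier ?R"
    then show "f \<oplus>\<^bsub>?R\<^esub> g \<in> carrier ?R"
      using Poly_Mapping.keys_add[of f g] by auto
  next
    fix f assume "f \<in> carrier ?R"
    then show "\<exists>g\<in>carrier ?R. g \<oplus>\<^bsub>?R\<^esub> f = \<zero>\<^bsub>?R\<^esub>"
      by (intro bexI[of _ "- f"]) auto
  qed (simp_all add: add.assoc add.commute)
  show "monoid ?R"
  proof (rule monoidI)
    fix f g assume fg: "f \<in> carrier ?R" "g \<in> carrier ?R"
    have "set w \<subseteq> S" if w: "w \<in> Poly_Mapping.keys (f * g)" for w
    proof -
      obtain u v where "w = u @ v" "u \<in> Poly_Mapping.keys f" "v \<in> Poly_Mapping.keys g"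
        using w Poly_Mapping.keys_mult[of f g] by (auto simp: plus_list_def)
      then show ?thesis
        using fg by auto
    qed
    then show "f \<otimes>\<^bsub>?R\<^esub> g \<in> carrier ?R"
      by simp
  qed (simp_all add: zero_list_def mult.assoc)
qed (simp_all add: distrib_left distrib_right)

section \<open>Universal enveloping algebras\<close>

text \<open>A Lie algebra over the field given by the type \<open>'f\<close> is represented by a
  \<^type>\<open>module\<close> record whose field \<^const>\<open>mult\<close> is the Lie bracket; the field
  \<^const>\<open>one\<close> is not used.\<close>

definition env_relations :: "('f::field, 'x) module \<Rightarrow> ('x list \<Rightarrow>\<^sub>0 'f) set" where
  "env_relations L =
     {gen (x \<oplus>\<^bsub>L\<^esub> y) - (gen x + gen y) |x y. x \<in> carrier L \<and> y \<in> carrier L} \<union>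
     {gen (a \<odot>\<^bsub>L\<^esub> x) - const a * gen x |a x. x \<in> carrier L} \<union>
     {gen x * gen y - gen y * gen x - gen (x \<otimes>\<^bsub>L\<^esub> y) |x y. x \<in> carrier L \<and> y \<in> carrier L}"

text \<open>The first two families of relations turn the free algebra on the set \<open>L\<close> into the tensor
  algebra of the vector space \<open>L\<close>.\<close>

definition env_ideal :: "('f::field, 'x) module \<Rightarrow> ('x list \<Rightarrow>\<^sub>0 'f) set" where
  "env_ideal L = Idl\<^bsub>free_algebra (carrier L)\<^esub> (env_relations L)"

definition univ_env :: "('f::field, 'x) module \<Rightarrow> ('x list \<Rightarrow>\<^sub>0 'f) set ring" where
  "univ_env L = free_algebra (carrier L) Quot env_ideal L"

definition env_inj :: "('f::field, 'x) module \<Rightarrow> 'x \<Rightarrow> ('x list \<Rightarrow>\<^sub>0 'f) set" where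
  "env_inj L x = env_ideal L +>\<^bsub>free_algebra (carrier L)\<^esub> gen x"

definition ring_center :: "('a, 'b) ring_scheme \<Rightarrow> 'a set" where
  "ring_center R = {z \<in> carrier R. \<forall>u\<in>carrier R. z \<otimes>\<^bsub>R\<^esub> u = u \<otimes>\<^bsub>R\<^esub> z}"

text \<open>The extension to \<^term>\<open>univ_env L\<close> of a representation \<open>\<rho>\<close> on \<open>V\<close>: a word
  \<open>x\<^sub>1 \<dots> x\<^sub>n\<close> acts as \<open>\<rho> x\<^sub>1 \<circ> \<dots> \<circ> \<rho> x\<^sub>n\<close>, and an element of \<^term>\<open>univ_env L\<close>, being a
  coset of noncommutative polynomials, acts through any of its representatives.\<close>

definition env_action ::
  "('f::field, 'v) module \<Rightarrow> ('x \<Rightarrow> 'v \<Rightarrow> 'v) \<Rightarrow> ('x list \<Rightarrow>\<^sub>0 'f) set \<Rightarrow> 'v \<Rightarrow> 'v" where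
  "env_action V \<rho> u v =
     the_elem ((\<lambda>f. \<Oplus>\<^bsub>V\<^esub>w\<in>Poly_Mapping.keys f. Poly_Mapping.lookup f w \<odot>\<^bsub>V\<^esub> foldr \<rho> w v) ` u)"

definition adjoint :: "('f, 'x) module \<Rightarrow> 'x \<Rightarrow> 'x \<Rightarrow> 'x" where
  "adjoint L x y = x \<otimes>\<^bsub>L\<^esub> y"

definition adjoint_character :: "('f::field, 'x) module \<Rightarrow> ('x list \<Rightarrow>\<^sub>0 'f) set \<Rightarrow> 'f" where
  "adjoint_character L c =
     (THE s. \<forall>y\<in>carrier L. env_action L (adjoint L) c y = s \<odot>\<^bsub>L\<^esub> y)"

lemma ideal_env_ideal:
  fixes L :: "('f::field, 'x) module"
  assumes L: "\<And>x y. x \<in> carrier L \<Longrightarrow> y \<in> carrier L \<Longrightarrow> x \<oplus>\<^bsub>L\<^esub> y \<in> carrier L"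
    "\<And>a x. x \<in> carrier L \<Longrightarrow> a \<odot>\<^bsub>L\<^esub> x \<in> carrier L"
    "\<And>x y. x \<in> carrier L \<Longrightarrow> y \<in> carrier L \<Longrightarrow> x \<otimes>\<^bsub>L\<^esub> y \<in> carrier L"
  shows "ideal (env_ideal L) (free_algebra (carrier L))"
proof -
  interpret R: ring "free_algebra (carrier L)" by (rule ring_free_algebra)
  have a_minus: "f - g \<in> carrier (free_algebra (carrier L))"
    if "f \<in> carrier (free_algebra (carrier L))" "g \<in> carrier (free_algebra (carrier L))" for f g
  proof -
    have "f + - g \<in> carrier (free_algebra (carrier L))"
      using that R.a_closed[of f "- g"] by simp
    then show ?thesis by simp
  qed
  have "env_relations L \<subseteq> carrier (free_algebra (carrier L))"
  proof -
    have g: "gen x \<in> carrier (free_algebra (carrier L))" if "x \<in> carrier L" for x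
      using that by (simp add: gen_def)
    have c: "const a \<in> carrier (free_algebra (carrier L))" for a :: 'f
      by (simp add: const_def)
    note add = R.a_closed[unfolded free_algebra_simps(5)]
    note mult = R.m_closed[unfolded free_algebra_simps(2)]
    have "gen (x \<oplus>\<^bsub>L\<^esub> y) - (gen x + gen y) \<in> carrier (free_algebra (carrier L))"
      if "x \<in> carrier L" "y \<in> carrier L" for x y
      by (rule a_minus[OF g[OF L(1)[OF that]] add[OF g[OF that(1)] g[OF that(2)]]])
    moreover have "gen (a \<odot>\<^bsub>L\<^esub> x) - const a * gen x \<in> carrier (free_algebra (carrier L))"
      if "x \<in> carrier L" for a x
      by (rule a_minus[OF g[OF L(2)[OF that]] mult[OF c g[OF that]]])
    moreover have "gen x * gen y - gen y * gen x - gen (x \<otimes>\<^bsub>L\<^esub> y) \<in> carrier (free_algebra (carrier L))"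
      if "x \<in> carrier L" "y \<in> carrier L" for x y
      by (rule a_minus[OF a_minus[OF mult[OF g[OF that(1)] g[OF that(2)]]
            mult[OF g[OF that(2)] g[OF that(1)]]] g[OF L(3)[OF that]]])
    ultimately show ?thesis
      unfolding env_relations_def by blast
  qed
  then show ?thesis
    unfolding env_ideal_def by (rule R.genideal_ideal)
qed

section \<open>The Lie algebra \<open>sl\<^sub>k\<close> and its Casimir elements\<close>

definition sl :: "nat \<Rightarrow> ('f::field, 'f mat) module" where
  "sl k =
    \<lparr>carrier = {A \<in> carrier_mat k k. (\<Sum>i<k. A $$ (i, i)) = 0},
     mult = (\<lambda>A B. A * B - B * A), one = undefined, zero = 0\<^sub>m k k, add = (+),
     smult = (\<cdot>\<^sub>m)\<rparr>"

lemma sl_closed: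
  assumes "A \<in> carrier (sl k)"
  shows "B \<in> carrier (sl k) \<Longrightarrow> A \<oplus>\<^bsub>sl k\<^esub> B \<in> carrier (sl k)"
    and "a \<odot>\<^bsub>sl k\<^esub> A \<in> carrier (sl k)"
    and "B \<in> carrier (sl k) \<Longrightarrow> A \<otimes>\<^bsub>sl k\<^esub> B \<in> carrier (sl k)"
proof -
  show "a \<odot>\<^bsub>sl k\<^esub> A \<in> carrier (sl k)"
    using assms by (auto simp: sl_def sum_distrib_left[symmetric])
next
  assume "B \<in> carrier (sl k)"
  then show "A \<oplus>\<^bsub>sl k\<^esub> B \<in> carrier (sl k)"
    using assms by (auto simp: sl_def sum.distrib)
next
  assume "B \<in> carrier (sl k)"
  with assms have AB: "A \<in> carrier_mat k k" "B \<in> carrier_mat k k"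
    by (auto simp: sl_def)
  have "(\<Sum>i<k. (A * B) $$ (i, i)) = (\<Sum>i<k. \<Sum>j<k. A $$ (i, j) * B $$ (j, i))"
    using AB by (auto simp: scalar_prod_def atLeast0LessThan intro!: sum.cong)
  also have "\<dots> = (\<Sum>j<k. \<Sum>i<k. B $$ (j, i) * A $$ (i, j))"
    by (subst sum.swap) (simp add: mult.commute)
  also have "\<dots> = (\<Sum>i<k. (B * A) $$ (i, i))"
    using AB by (auto simp: scalar_prod_def atLeast0LessThan intro!: sum.cong)
  finally have "(\<Sum>i<k. (A * B - B * A) $$ (i, i)) = 0"
    using AB by (simp add: sum_subtractf)
  then show "A \<otimes>\<^bsub>sl k\<^esub> B \<in> carrier (sl k)"
    using AB by (auto simp: sl_def)
qed

lemma ring_univ_env_sl: "ring (univ_env (sl k))"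
  unfolding univ_env_def by (intro ideal.quotient_is_ring ideal_env_ideal sl_closed)

text \<open>Indices \<open>i\<close>, \<open>j\<close> below range over \<open>1, \<dots>, k\<close>, whereas the entries of a
  \<^type>\<open>mat\<close> are numbered from \<open>0\<close>.\<close>

definition matrix_unit :: "nat \<Rightarrow> nat \<Rightarrow> nat \<Rightarrow> 'f::field mat" where
  "matrix_unit k i j = mat k k (\<lambda>(r, s). if Suc r = i \<and> Suc s = j then 1 else 0)"

definition sl_h :: "nat \<Rightarrow> nat \<Rightarrow> 'f::field mat" where
  "sl_h k i = matrix_unit k i i - matrix_unit k (Suc i) (Suc i)"

definition sl_alpha :: "nat \<Rightarrow> nat \<Rightarrow> nat \<Rightarrow> 'f::field" where
  "sl_alpha k i j = (if i \<le> j then of_nat k - of_nat j else - of_nat j)"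

definition sl_x :: "nat \<Rightarrow> nat \<Rightarrow> nat \<Rightarrow> 'f::field mat" where
  "sl_x k i j =
     (if i \<noteq> j then matrix_unit k i j
      else (1 / of_nat k) \<odot>\<^bsub>sl k\<^esub> (\<Oplus>\<^bsub>sl k\<^esub>l\<in>{1..<k}. sl_alpha k i l \<odot>\<^bsub>sl k\<^esub> sl_h k l))"

text \<open>A summation index \<open>(i\<^sub>1, \<dots>, i\<^sub>p)\<close> is a list \<open>is\<close> of length \<open>p\<close>; the factor at position \<open>m\<close>
  has lower index at position \<open>m + 1\<close>, taken cyclically.\<close>

definition casimir :: "nat \<Rightarrow> nat \<Rightarrow> ('f::field mat list \<Rightarrow>\<^sub>0 'f) set" where
  "casimir p k =
     (\<Oplus>\<^bsub>univ_env (sl k)\<^esub>is\<in>{is. length is = p \<and> set is \<subseteq> {1..k}}.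
        foldr (\<lambda>m u. env_inj (sl k) (sl_x k (is ! m) (is ! (Suc m mod p))) \<otimes>\<^bsub>univ_env (sl k)\<^esub> u)
          [0..<p] \<one>\<^bsub>univ_env (sl k)\<^esub>)"

definition casimir_eigenvalue :: "nat \<Rightarrow> nat \<Rightarrow> 'f::field" where
  "casimir_eigenvalue p k = (if p = 1 then 0 else adjoint_character (sl k) (casimir p k))"

end

theory Submission
  imports Defs
begin

text \<open>Write \<open>E\<close> for the \<open>k \<times> k\<close> matrix whose \<open>(i, j)\<close> entry is the generator \<open>x\<^sub>i\<^sub>j\<close>, as a matrix over the
enveloping algebra. Then the Casimir element of degree \<open>p\<close> is the trace of \<open>E\<^sup>p\<close>, and both parts of
the statement follow from formulas for the individual entries of \<open>E\<^sup>p\<close>, which, unlike their trace,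
can be proved by induction on \<open>p\<close>.

Centrality. The matrix \<open>x\<^sub>i\<^sub>j\<close> is the matrix unit \<open>e\<^sub>i\<^sub>j\<close> minus a scalar matrix, so for \<open>Y\<close> in
\<open>sl\<^sub>k\<close> the bracket \<open>[Y, x\<^sub>i\<^sub>j]\<close> is \<open>\<Sum>\<^sub>a Y\<^sub>a\<^sub>i x\<^sub>a\<^sub>j - \<Sum>\<^sub>b Y\<^sub>j\<^sub>b x\<^sub>i\<^sub>b\<close>: the scalar corrections on the two sides
cancel. By the Leibniz rule the entries of \<open>E\<^sup>p\<close> satisfy the same relation
(\<open>commutator_path_sum\<close>), and summing over \<open>i = j\<close> the two sums cancel. Hence the trace commutes
with all generators of the enveloping algebra.

Eigenvalue. In the adjoint representation the entry \<open>(i, j)\<close> of \<open>E\<^sup>p\<close> maps \<open>Y\<close> to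
\<open>a e\<^sub>i\<^sub>j Y + b Y e\<^sub>i\<^sub>j + c \<delta>\<^sub>i\<^sub>j Y + d Y\<^sub>j\<^sub>i 1\<close> with scalars depending only on \<open>p\<close> and \<open>k\<close>
(\<open>sl_path_sum_act_entry\<close>). Applying one more factor sends \<open>(a, b, c, d)\<close> to
\<open>(k a + c, - c, - b, - a)\<close>, where \<open>tr Y = 0\<close> removes one more term. Starting from \<open>(0, 0, 1, 0)\<close> this
gives \<open>c = 1\<close>, \<open>b = 0\<close> for even \<open>p\<close> and \<open>c = 0\<close>, \<open>b = - 1\<close> for odd \<open>p\<close>. Summing over \<open>i = j\<close> the
eigenvalue is \<open>a + b + k c\<close>, and the recursion for \<open>a\<close> yields that for \<open>\<lambda>\<close>.

All computations take place with noncommutative polynomials modulo the ideal of relations. The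
results pass to the enveloping algebra because taking cosets is a ring homomorphism
(\<open>casimir_eq_coset\<close>) and because a polynomial in the ideal acts as zero in every representation
(\<open>env_ideal_acts_trivially\<close>), so that the action of a coset can be computed on any representative.\<close>

section \<open>Noncommutative polynomials and their quotients\<close>

text \<open>Every polynomial is the sum of its terms, so additive properties need only be checked on single
terms. The restriction to words over \<open>S\<close> is kept along the way.\<close>

lemma free_algebra_induct [consumes 1, case_names zero monom sum]:
  fixes f :: "'x list \<Rightarrow>\<^sub>0 'f::field"
  assumes "f \<in> carrier (free_algebra S)"
    and zero: "P 0"
    and monom: "\<And>w a. set w \<subseteq> S \<Longrightarrow> P (Poly_Mapping.single w a)"
    and sum: "\<And>f g. f \<in> carrier (free_algebra S) \<Longrightarrow> g \<in> carrier (free_algebra S) \<Longrightarrow>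
      P f \<Longrightarrow> P g \<Longrightarrow> P (f + g)"
  shows "P f"
proof -
  interpret R: ring "free_algebra S :: ('x list \<Rightarrow>\<^sub>0 'f) ring" by (rule ring_free_algebra)
  have "(\<Sum>w\<in>A. Poly_Mapping.single w (Poly_Mapping.lookup f w)) \<in> carrier (free_algebra S) \<and>
      P (\<Sum>w\<in>A. Poly_Mapping.single w (Poly_Mapping.lookup f w))"
    if "finite A" "A \<subseteq> Poly_Mapping.keys f" for A
    using that
  proof (induction A rule: finite_induct)
    case empty
    show ?case using zero by simp
  next
    case (insert w A)
    have w: "set w \<subseteq> S" using insert.prems assms(1) by auto
    then have "Poly_Mapping.single w (Poly_Mapping.lookup f w) \<in> carrier (free_algebra S)"
      by simp
    then show ?case
      using insert R.a_closed[of "Poly_Mapping.single w (Poly_Mapping.lookup f w)"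
          "\<Sum>w\<in>A. Poly_Mapping.single w (Poly_Mapping.lookup f w)"]
        sum[OF _ _ monom[OF w]]
      by (simp del: free_algebra_simps(1))
  qed
  from this[of "Poly_Mapping.keys f"]
  have "P (\<Sum>w\<in>Poly_Mapping.keys f. Poly_Mapping.single w (Poly_Mapping.lookup f w))"
    by simp
  also have "(\<Sum>w\<in>Poly_Mapping.keys f. Poly_Mapping.single w (Poly_Mapping.lookup f w)) = f"
    by (rule poly_mapping_eqI)
      (auto simp: lookup_sum lookup_single when_def in_keys_iff)
  finally show ?thesis .
qed

lemma free_algebra_sum_closed:
  assumes "\<And>i. i \<in> A \<Longrightarrow> f i \<in> carrier (free_algebra S)"
  shows "(\<Sum>i\<in>A. f i) \<in> carrier (free_algebra S)"
proof -
  interpret R: ring "free_algebra S :: ('b list \<Rightarrow>\<^sub>0 'c) ring" by (rule ring_free_algebra)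
  show ?thesis
    using assms R.zero_closed R.a_closed
    by (induction A rule: infinite_finite_induct) (simp_all del: free_algebra_simps(1))
qed

lemma free_algebra_mult_closed:
  "f \<in> carrier (free_algebra S) \<Longrightarrow> g \<in> carrier (free_algebra S) \<Longrightarrow> f * g \<in> carrier (free_algebra S)"
  using ring.ring_simprules(5)[OF ring_free_algebra, of f S g] by simp

text \<open>The closure properties of ideals, with the operations of the polynomial type in place of those of the
ring record, so that congruences can be verified by ordinary simplification.\<close>

lemma free_algebra_ideal_closed:
  assumes "ideal I (free_algebra S)"
  shows "0 \<in> I" "f \<in> I \<Longrightarrow> g \<in> I \<Longrightarrow> f + g \<in> I"
    "f \<in> I \<Longrightarrow> g \<in> carrier (free_algebra S) \<Longrightarrow> f * g \<in> I"
    "f \<in> I \<Longrightarrow> g \<in> carrier (free_algebra S) \<Longrightarrow> g * f \<in> I"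
  using ideal.I_l_closed[OF assms, of f g] ideal.I_r_closed[OF assms, of f g]
    additive_subgroup.zero_closed[OF ideal.axioms(1)[OF assms]]
    additive_subgroup.a_closed[OF ideal.axioms(1)[OF assms], of f g]
  by simp_all

lemma free_algebra_ideal_sum_closed:
  assumes "ideal I (free_algebra S)" "\<And>i. i \<in> A \<Longrightarrow> f i \<in> I"
  shows "(\<Sum>i\<in>A. f i) \<in> I"
  using assms(2) free_algebra_ideal_closed(1,2)[OF assms(1)]
  by (induction A rule: infinite_finite_induct) auto

lemma const_central: "const a * f = f * (const a :: 'x list \<Rightarrow>\<^sub>0 'f::field)"
proof -
  have "f \<in> carrier (free_algebra UNIV)" by simp
  then show ?thesis
    by (induction f rule: free_algebra_induct)
      (simp_all add: const_def mult_single algebra_simps plus_list_def)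
qed

lemma coset_foldr:
  fixes x :: "'m \<Rightarrow> 'x list \<Rightarrow>\<^sub>0 'f::field"
  assumes I: "ideal I (free_algebra S)" and "\<And>m. m \<in> set ms \<Longrightarrow> x m \<in> carrier (free_algebra S)"
  shows "foldr (\<lambda>m u. x m * u) ms 1 \<in> carrier (free_algebra S)"
    "foldr (\<lambda>m u. (I +>\<^bsub>free_algebra S\<^esub> x m) \<otimes>\<^bsub>free_algebra S Quot I\<^esub> u) ms \<one>\<^bsub>free_algebra S Quot I\<^esub> =
      I +>\<^bsub>free_algebra S\<^esub> foldr (\<lambda>m u. x m * u) ms 1"
proof -
  note hom = ideal.rcos_ring_hom[OF I]
  have "foldr (\<lambda>m u. x m * u) ms 1 \<in> carrier (free_algebra S) \<and>
    foldr (\<lambda>m u. (I +>\<^bsub>free_algebra S\<^esub> x m) \<otimes>\<^bsub>free_algebra S Quot I\<^esub> u) ms \<one>\<^bsub>free_algebra S Quot I\<^esub> =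
      I +>\<^bsub>free_algebra S\<^esub> foldr (\<lambda>m u. x m * u) ms 1"
    using assms(2)
  proof (induction ms)
    case Nil
    show ?case using ring_hom_one[OF hom] by (simp add: zero_list_def)
  next
    case (Cons m ms)
    then show ?case
      using ring_hom_mult[OF hom, of "x m" "foldr (\<lambda>m u. x m * u) ms 1"]
      by (simp add: free_algebra_mult_closed del: free_algebra_simps(1))
  qed
  then show "foldr (\<lambda>m u. x m * u) ms 1 \<in> carrier (free_algebra S)"
    "foldr (\<lambda>m u. (I +>\<^bsub>free_algebra S\<^esub> x m) \<otimes>\<^bsub>free_algebra S Quot I\<^esub> u) ms \<one>\<^bsub>free_algebra S Quot I\<^esub> =
      I +>\<^bsub>free_algebra S\<^esub> foldr (\<lambda>m u. x m * u) ms 1"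
    by blast+
qed

lemma coset_finsum:
  fixes f :: "'i \<Rightarrow> 'x list \<Rightarrow>\<^sub>0 'f::field"
  assumes I: "ideal I (free_algebra S)" and "finite A" "\<And>i. i \<in> A \<Longrightarrow> f i \<in> carrier (free_algebra S)"
  shows "(\<Oplus>\<^bsub>free_algebra S Quot I\<^esub>i\<in>A. I +>\<^bsub>free_algebra S\<^esub> f i) = I +>\<^bsub>free_algebra S\<^esub> (\<Sum>i\<in>A. f i)"
proof -
  note hom = ideal.rcos_ring_hom[OF I]
  interpret R: ring "free_algebra S :: ('x list \<Rightarrow>\<^sub>0 'f) ring" by (rule ring_free_algebra)
  interpret Q: ring "free_algebra S Quot I" by (rule ideal.quotient_is_ring[OF I])
  show ?thesis
    using assms(2,3)
  proof (induction A rule: finite_induct)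
    case empty
    show ?case using ring_hom_zero[OF hom R.ring_axioms Q.ring_axioms] by simp
  next
    case (insert i A)
    then have "(\<Sum>i\<in>A. f i) \<in> carrier (free_algebra S)" by (intro free_algebra_sum_closed) auto
    then show ?case
      using insert ring_hom_add[OF hom, of "f i" "\<Sum>i\<in>A. f i"] ring_hom_closed[OF hom]
      by (simp add: Q.finsum_insert Pi_def del: free_algebra_simps(1))
  qed
qed

text \<open>The elements that commute with \<open>c\<close> modulo an ideal form a subalgebra:
\<open>[x w, c] = x [w, c] + [x, c] w\<close>.\<close>

lemma commutes_mod_ideal:
  fixes c f :: "'x list \<Rightarrow>\<^sub>0 'f::field"
  assumes I: "ideal I (free_algebra S)" and c: "c \<in> carrier (free_algebra S)"
    and gen: "\<And>x. x \<in> S \<Longrightarrow> gen x * c - c * gen x \<in> I"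
    and f: "f \<in> carrier (free_algebra S)"
  shows "f * c - c * f \<in> I"
  using f
proof (induction f rule: free_algebra_induct)
  case zero
  then show ?case using free_algebra_ideal_closed(1)[OF I] by simp
next
  case (monom w a)
  then show ?case
  proof (induction w)
    case Nil
    have "Poly_Mapping.single [] a * c - c * Poly_Mapping.single [] a = 0"
      using const_central[of a c] by (simp add: const_def)
    then show ?case using free_algebra_ideal_closed(1)[OF I] by simp
  next
    case (Cons x w)
    let ?w = "Poly_Mapping.single w a"
    have w: "?w \<in> carrier (free_algebra S)" and x: "gen x \<in> carrier (free_algebra S :: ('x list \<Rightarrow>\<^sub>0 'f) ring)"
      using Cons.prems by (auto simp: gen_def)
    have "Poly_Mapping.single (x # w) a = gen x * ?w"
      by (simp add: gen_def mult_single plus_list_def)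
    then have "Poly_Mapping.single (x # w) a * c - c * Poly_Mapping.single (x # w) a =
        gen x * (?w * c - c * ?w) + (gen x * c - c * gen x) * ?w"
      by (simp add: algebra_simps)
    moreover have "gen x * (?w * c - c * ?w) \<in> I"
      using Cons free_algebra_ideal_closed(4)[OF I _ x] by simp
    moreover have "(gen x * c - c * gen x) * ?w \<in> I"
      using Cons.prems gen free_algebra_ideal_closed(3)[OF I _ w] by simp
    ultimately show ?case using free_algebra_ideal_closed(2)[OF I] by simp
  qed
next
  case (sum f g)
  have "(f + g) * c - c * (f + g) = (f * c - c * f) + (g * c - c * g)"
    by (simp add: algebra_simps)
  then show ?case using sum free_algebra_ideal_closed(2)[OF I] by simp
qed

lemma coset_in_ring_center:
  fixes c :: "'x list \<Rightarrow>\<^sub>0 'f::field"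
  assumes I: "ideal I (free_algebra S)" and c: "c \<in> carrier (free_algebra S)"
    and gen: "\<And>x. x \<in> S \<Longrightarrow> gen x * c - c * gen x \<in> I"
  shows "I +>\<^bsub>free_algebra S\<^esub> c \<in> ring_center (free_algebra S Quot I)"
proof -
  interpret I: ideal I "free_algebra S" by fact
  have *: "I +>\<^bsub>free_algebra S\<^esub> (c * f) = I +>\<^bsub>free_algebra S\<^esub> (f * c)"
    if f: "f \<in> carrier (free_algebra S)" for f
  proof (rule I.a_repr_independence)
    note cf = free_algebra_mult_closed[OF c f]
    have "f * c = (f * c - c * f) + c * f" by simp
    then show "f * c \<in> I +>\<^bsub>free_algebra S\<^esub> (c * f)"
      using commutes_mod_ideal[OF assms f] unfolding a_r_coset_def'
      by (auto intro!: bexI[of _ "f * c - c * f"])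
  qed (use free_algebra_mult_closed[OF c f] I.a_subgroup in auto)
  show ?thesis
    unfolding ring_center_def
  proof (intro CollectI conjI ballI)
    show "I +>\<^bsub>free_algebra S\<^esub> c \<in> carrier (free_algebra S Quot I)"
      using ring_hom_closed[OF I.rcos_ring_hom c] .
    fix u assume "u \<in> carrier (free_algebra S Quot I)"
    then obtain f where f: "f \<in> carrier (free_algebra S)" "u = I +>\<^bsub>free_algebra S\<^esub> f"
      unfolding FactRing_def using A_RCOSETS_def'[of "free_algebra S" I] by auto
    show "(I +>\<^bsub>free_algebra S\<^esub> c) \<otimes>\<^bsub>free_algebra S Quot I\<^esub> u =
        u \<otimes>\<^bsub>free_algebra S Quot I\<^esub> (I +>\<^bsub>free_algebra S\<^esub> c)"
      using ring_hom_mult[OF I.rcos_ring_hom c f(1)] ring_hom_mult[OF I.rcos_ring_hom f(1) c]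
        *[OF f(1)] f(2) by simp
  qed
qed

section \<open>Relations in an enveloping algebra\<close>

lemma env_ideal_relations:
  fixes L :: "('f::field, 'x) module"
  assumes "x \<in> carrier L"
  shows "gen (a \<odot>\<^bsub>L\<^esub> x) - const a * gen x \<in> env_ideal L"
    and "y \<in> carrier L \<Longrightarrow> gen (x \<oplus>\<^bsub>L\<^esub> y) - (gen x + gen y) \<in> env_ideal L"
    and "y \<in> carrier L \<Longrightarrow> gen x * gen y - gen y * gen x - gen (x \<otimes>\<^bsub>L\<^esub> y) \<in> env_ideal L"
proof -
  have relation: "f \<in> env_ideal L" if "f \<in> env_relations L" for f
    using that unfolding env_ideal_def genideal_def by auto
  show "gen (a \<odot>\<^bsub>L\<^esub> x) - const a * gen x \<in> env_ideal L"
    by (rule relation, unfold env_relations_def, rule UnI1, rule UnI2)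
      (rule CollectI, rule exI[of _ a], rule exI[of _ x], simp add: assms)
  show "gen (x \<oplus>\<^bsub>L\<^esub> y) - (gen x + gen y) \<in> env_ideal L" if "y \<in> carrier L"
    by (rule relation, unfold env_relations_def, rule UnI1, rule UnI1)
      (rule CollectI, rule exI[of _ x], rule exI[of _ y], simp add: assms that)
  show "gen x * gen y - gen y * gen x - gen (x \<otimes>\<^bsub>L\<^esub> y) \<in> env_ideal L" if "y \<in> carrier L"
    by (rule relation, unfold env_relations_def, rule UnI2)
      (rule CollectI, rule exI[of _ x], rule exI[of _ y], simp add: assms that)
qed

text \<open>The relations make \<open>gen\<close> linear modulo the ideal. That \<open>gen\<close> maps \<open>\<zero>\<close> into the ideal is not itself
a relation; it comes from the additive relation for \<open>\<zero> \<oplus> \<zero>\<close>.\<close>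

lemma gen_finsum:
  fixes L :: "('f::field, 'x) module"
  assumes I: "ideal (env_ideal L) (free_algebra (carrier L))" and L: "abelian_monoid L"
    and smult: "\<And>a x. x \<in> carrier L \<Longrightarrow> a \<odot>\<^bsub>L\<^esub> x \<in> carrier L"
    and "finite A" "\<And>i. i \<in> A \<Longrightarrow> x i \<in> carrier L"
  shows "gen (\<Oplus>\<^bsub>L\<^esub>i\<in>A. a i \<odot>\<^bsub>L\<^esub> x i) - (\<Sum>i\<in>A. const (a i) * gen (x i)) \<in> env_ideal L"
proof -
  interpret L: abelian_monoid L by fact
  note closed = free_algebra_ideal_closed[OF I]
  show ?thesis
    using assms(4,5)
  proof (induction A rule: finite_induct)
    case empty
    have "gen \<zero>\<^bsub>L\<^esub> - (gen \<zero>\<^bsub>L\<^esub> + gen \<zero>\<^bsub>L\<^esub>) \<in> env_ideal L"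
      using env_ideal_relations(2)[of "\<zero>\<^bsub>L\<^esub>" L "\<zero>\<^bsub>L\<^esub>"] by simp
    \<comment> \<open>The left-hand side equals \<open>- gen \<zero>\<close>.\<close>
    from closed(3)[OF this, of "- 1"] show ?case by (simp add: zero_list_def)
  next
    case (insert i A)
    let ?S = "\<Oplus>\<^bsub>L\<^esub>i\<in>A. a i \<odot>\<^bsub>L\<^esub> x i"
    have S: "?S \<in> carrier L" using insert smult by (intro L.finsum_closed) auto
    have i: "x i \<in> carrier L" using insert by simp
    have "gen (a i \<odot>\<^bsub>L\<^esub> x i \<oplus>\<^bsub>L\<^esub> ?S) - (gen (a i \<odot>\<^bsub>L\<^esub> x i) + gen ?S) +
       ((gen (a i \<odot>\<^bsub>L\<^esub> x i) - const (a i) * gen (x i)) +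
        (gen ?S - (\<Sum>i\<in>A. const (a i) * gen (x i)))) \<in> env_ideal L"
      using insert by (intro closed(2) env_ideal_relations(1,2) smult i S) auto
    moreover have "(\<Oplus>\<^bsub>L\<^esub>i\<in>insert i A. a i \<odot>\<^bsub>L\<^esub> x i) = a i \<odot>\<^bsub>L\<^esub> x i \<oplus>\<^bsub>L\<^esub> ?S"
      using insert smult by (simp add: L.finsum_insert Pi_def)
    ultimately show ?case using insert by (simp add: algebra_simps)
  qed
qed

section \<open>The action of an enveloping algebra on a representation\<close>

text \<open>A representation \<open>\<rho>\<close> of \<open>L\<close> on \<open>V\<close>, given by the identities that make \<open>env_action\<close> well defined:
\<open>V\<close> is a vector space, \<open>\<rho>\<close> is bilinear, and \<open>\<rho>\<close> turns brackets into commutators. The last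
identity is stated without subtraction.\<close>

locale lie_representation = V: abelian_group V
  for L :: "('f::field, 'x) module" and V :: "('f, 'v) module" and \<rho> :: "'x \<Rightarrow> 'v \<Rightarrow> 'v" +
  assumes add_closed: "x \<in> carrier L \<Longrightarrow> y \<in> carrier L \<Longrightarrow> x \<oplus>\<^bsub>L\<^esub> y \<in> carrier L"
    and smult_closed: "x \<in> carrier L \<Longrightarrow> a \<odot>\<^bsub>L\<^esub> x \<in> carrier L"
    and bracket_closed: "x \<in> carrier L \<Longrightarrow> y \<in> carrier L \<Longrightarrow> x \<otimes>\<^bsub>L\<^esub> y \<in> carrier L"
    and scale_closed: "v \<in> carrier V \<Longrightarrow> a \<odot>\<^bsub>V\<^esub> v \<in> carrier V"
    and scale_add: "v \<in> carrier V \<Longrightarrow> w \<in> carrier V \<Longrightarrow>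
      a \<odot>\<^bsub>V\<^esub> (v \<oplus>\<^bsub>V\<^esub> w) = a \<odot>\<^bsub>V\<^esub> v \<oplus>\<^bsub>V\<^esub> a \<odot>\<^bsub>V\<^esub> w"
    and add_scale: "v \<in> carrier V \<Longrightarrow> (a + b) \<odot>\<^bsub>V\<^esub> v = a \<odot>\<^bsub>V\<^esub> v \<oplus>\<^bsub>V\<^esub> b \<odot>\<^bsub>V\<^esub> v"
    and scale_scale: "v \<in> carrier V \<Longrightarrow> a \<odot>\<^bsub>V\<^esub> (b \<odot>\<^bsub>V\<^esub> v) = (a * b) \<odot>\<^bsub>V\<^esub> v"
    and one_scale: "v \<in> carrier V \<Longrightarrow> 1 \<odot>\<^bsub>V\<^esub> v = v"
    and rho_closed: "x \<in> carrier L \<Longrightarrow> v \<in> carrier V \<Longrightarrow> \<rho> x v \<in> carrier V"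
    and rho_add: "x \<in> carrier L \<Longrightarrow> v \<in> carrier V \<Longrightarrow> w \<in> carrier V \<Longrightarrow>
      \<rho> x (v \<oplus>\<^bsub>V\<^esub> w) = \<rho> x v \<oplus>\<^bsub>V\<^esub> \<rho> x w"
    and rho_scale: "x \<in> carrier L \<Longrightarrow> v \<in> carrier V \<Longrightarrow> \<rho> x (a \<odot>\<^bsub>V\<^esub> v) = a \<odot>\<^bsub>V\<^esub> \<rho> x v"
    and add_rho: "x \<in> carrier L \<Longrightarrow> y \<in> carrier L \<Longrightarrow> v \<in> carrier V \<Longrightarrow>
      \<rho> (x \<oplus>\<^bsub>L\<^esub> y) v = \<rho> x v \<oplus>\<^bsub>V\<^esub> \<rho> y v"
    and smult_rho: "x \<in> carrier L \<Longrightarrow> v \<in> carrier V \<Longrightarrow> \<rho> (a \<odot>\<^bsub>L\<^esub> x) v = a \<odot>\<^bsub>V\<^esub> \<rho> x v"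
    and bracket_rho: "x \<in> carrier L \<Longrightarrow> y \<in> carrier L \<Longrightarrow> v \<in> carrier V \<Longrightarrow>
      \<rho> (x \<otimes>\<^bsub>L\<^esub> y) v \<oplus>\<^bsub>V\<^esub> \<rho> y (\<rho> x v) = \<rho> x (\<rho> y v)"
begin

abbreviation "T \<equiv> free_algebra (carrier L) :: ('x list \<Rightarrow>\<^sub>0 'f) ring"

interpretation T: ring T by (rule ring_free_algebra)

lemma zero_scale: "v \<in> carrier V \<Longrightarrow> 0 \<odot>\<^bsub>V\<^esub> v = \<zero>\<^bsub>V\<^esub>"
  using add_scale[of v 0 0] scale_closed[of v 0] V.add.r_cancel_one by fastforce

lemma word_closed: "set w \<subseteq> carrier L \<Longrightarrow> v \<in> carrier V \<Longrightarrow> foldr \<rho> w v \<in> carrier V"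
  by (induction w) (auto simp: rho_closed)

lemma word_add: "set w \<subseteq> carrier L \<Longrightarrow> v \<in> carrier V \<Longrightarrow> v' \<in> carrier V \<Longrightarrow>
    foldr \<rho> w (v \<oplus>\<^bsub>V\<^esub> v') = foldr \<rho> w v \<oplus>\<^bsub>V\<^esub> foldr \<rho> w v'"
  by (induction w) (auto simp: rho_add word_closed)

lemma word_scale: "set w \<subseteq> carrier L \<Longrightarrow> v \<in> carrier V \<Longrightarrow>
    foldr \<rho> w (a \<odot>\<^bsub>V\<^esub> v) = a \<odot>\<^bsub>V\<^esub> foldr \<rho> w v"
  by (induction w) (auto simp: rho_scale word_closed)

text \<open>The action of a polynomial before passing to cosets, for which additivity and multiplicativity can be
proved one term at a time.\<close>

definition act :: "('x list \<Rightarrow>\<^sub>0 'f) \<Rightarrow> 'v \<Rightarrow> 'v" where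
  "act f v = (\<Oplus>\<^bsub>V\<^esub>w\<in>Poly_Mapping.keys f. Poly_Mapping.lookup f w \<odot>\<^bsub>V\<^esub> foldr \<rho> w v)"

lemma act_closed: "f \<in> carrier T \<Longrightarrow> v \<in> carrier V \<Longrightarrow> act f v \<in> carrier V"
  unfolding act_def by (intro V.finsum_closed) (auto intro!: scale_closed word_closed)

lemma act_zero [simp]: "act 0 v = \<zero>\<^bsub>V\<^esub>"
  by (simp add: act_def)

lemma act_single:
  assumes "set w \<subseteq> carrier L" "v \<in> carrier V"
  shows "act (Poly_Mapping.single w a) v = a \<odot>\<^bsub>V\<^esub> foldr \<rho> w v"
  using assms V.add.finprod_singleton[of w "{w}" "\<lambda>w'. a \<odot>\<^bsub>V\<^esub> foldr \<rho> w' v"]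
  by (cases "a = 0") (auto simp: act_def zero_scale word_closed scale_closed Pi_def)

text \<open>Two polynomials have different sets of keys in general. Their actions can be added once both are written as
sums over a common set of words.\<close>

lemma act_superset:
  assumes "f \<in> carrier T" "v \<in> carrier V" "Poly_Mapping.keys f \<subseteq> A" "finite A"
    "\<And>w. w \<in> A \<Longrightarrow> set w \<subseteq> carrier L"
  shows "act f v = (\<Oplus>\<^bsub>V\<^esub>w\<in>A. Poly_Mapping.lookup f w \<odot>\<^bsub>V\<^esub> foldr \<rho> w v)"
  unfolding act_def
  by (rule V.add.finprod_mono_neutral_cong_left)
    (use assms in \<open>auto simp: in_keys_iff zero_scale word_closed intro!: scale_closed\<close>)

lemma act_sum:
  assumes "f \<in> carrier T" "g \<in> carrier T" "v \<in> carrier V"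
  shows "act (f + g) v = act f v \<oplus>\<^bsub>V\<^esub> act g v"
proof -
  let ?A = "Poly_Mapping.keys f \<union> Poly_Mapping.keys g"
  have A: "\<And>w. w \<in> ?A \<Longrightarrow> set w \<subseteq> carrier L" using assms by auto
  have "f + g \<in> carrier T" using T.a_closed[OF assms(1,2)] by simp
  then have "act (f + g) v =
      (\<Oplus>\<^bsub>V\<^esub>w\<in>?A. Poly_Mapping.lookup (f + g) w \<odot>\<^bsub>V\<^esub> foldr \<rho> w v)"
    using assms(3) A Poly_Mapping.keys_add[of f g] by (intro act_superset) auto
  also have "\<dots> = (\<Oplus>\<^bsub>V\<^esub>w\<in>?A. Poly_Mapping.lookup f w \<odot>\<^bsub>V\<^esub> foldr \<rho> w v \<oplus>\<^bsub>V\<^esub>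
      Poly_Mapping.lookup g w \<odot>\<^bsub>V\<^esub> foldr \<rho> w v)"
    by (rule V.finsum_cong')
      (use A assms(3) in \<open>auto simp: lookup_add add_scale word_closed scale_closed intro!: V.a_closed\<close>)
  also have "\<dots> = act f v \<oplus>\<^bsub>V\<^esub> act g v"
    using A assms(3) act_superset[OF assms(1,3), of ?A] act_superset[OF assms(2,3), of ?A]
    by (subst V.finsum_addf) (auto intro!: scale_closed word_closed)
  finally show ?thesis .
qed

lemma act_uminus:
  assumes "f \<in> carrier T" "v \<in> carrier V"
  shows "act (- f) v = \<ominus>\<^bsub>V\<^esub> act f v"
proof -
  have f: "- f \<in> carrier T" using assms by simp
  have "act (- f) v \<oplus>\<^bsub>V\<^esub> act f v = \<zero>\<^bsub>V\<^esub>"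
    using act_sum[OF f assms] by simp
  then show ?thesis
    using V.minus_equality act_closed[OF assms] act_closed[OF f assms(2)] by metis
qed

lemma act_add_arg:
  assumes "f \<in> carrier T" "v \<in> carrier V" "w \<in> carrier V"
  shows "act f (v \<oplus>\<^bsub>V\<^esub> w) = act f v \<oplus>\<^bsub>V\<^esub> act f w"
  using assms(1)
proof (induction f rule: free_algebra_induct)
  case (sum f g)
  then show ?case
    using assms by (simp add: act_sum act_closed V.a_ac del: free_algebra_simps(1))
qed (use assms in \<open>simp_all add: act_single word_add scale_add word_closed\<close>)

lemma act_scale_arg:
  assumes "f \<in> carrier T" "v \<in> carrier V"
  shows "act f (a \<odot>\<^bsub>V\<^esub> v) = a \<odot>\<^bsub>V\<^esub> act f v"
  using assms(1)
proof (induction f rule: free_algebra_induct)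
  case zero
  show ?case
    using scale_scale[of v a 0] zero_scale assms by simp
next
  case (sum f g)
  then show ?case
    using assms by (simp add: act_sum act_closed scale_add scale_closed del: free_algebra_simps(1))
qed (use assms in \<open>simp_all add: act_single scale_closed word_scale scale_scale word_closed mult.commute\<close>)

lemma act_zero_arg: "f \<in> carrier T \<Longrightarrow> act f \<zero>\<^bsub>V\<^esub> = \<zero>\<^bsub>V\<^esub>"
  by (metis V.zero_closed act_closed act_scale_arg zero_scale)

text \<open>Both sides are additive in \<open>f\<close> and in \<open>g\<close>, and for single terms the claim is that concatenating words
composes their operators.\<close>

lemma act_mult:
  assumes "f \<in> carrier T" "g \<in> carrier T" "v \<in> carrier V"
  shows "act (f * g) v = act f (act g v)"
  using assms(1)
proof (induction f rule: free_algebra_induct)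
  case zero
  show ?case by simp
next
  case (sum f f')
  have "act ((f + f') * g) v = act (f * g + f' * g) v"
    by (simp add: distrib_right)
  also have "\<dots> = act (f * g) v \<oplus>\<^bsub>V\<^esub> act (f' * g) v"
    using T.m_closed[OF sum(1) assms(2)] T.m_closed[OF sum(2) assms(2)] assms(3)
    by (intro act_sum) (simp_all del: free_algebra_simps(1))
  finally show ?case
    using sum assms by (simp add: act_sum act_closed del: free_algebra_simps(1))
next
  case (monom u a)
  then have u: "Poly_Mapping.single u a \<in> carrier T" by auto
  show ?case
    using assms(2)
  proof (induction g rule: free_algebra_induct)
    case zero
    show ?case using u by (simp add: act_zero_arg del: free_algebra_simps(1))
  next
    case (monom w b)
    then show ?case
      using \<open>set u \<subseteq> carrier L\<close> assms(3)
      by (simp add: mult_single act_single word_closed scale_closed word_scale scale_scale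
          plus_list_def)
  next
    case (sum g g')
    have "act (Poly_Mapping.single u a * (g + g')) v =
        act (Poly_Mapping.single u a * g + Poly_Mapping.single u a * g') v"
      by (simp add: distrib_left)
    also have "\<dots> = act (Poly_Mapping.single u a * g) v \<oplus>\<^bsub>V\<^esub> act (Poly_Mapping.single u a * g') v"
      using T.m_closed[OF u sum(1)] T.m_closed[OF u sum(2)] assms(3)
      by (intro act_sum) (simp_all del: free_algebra_simps(1))
    finally show ?case
      using sum assms u by (simp add: act_sum act_closed act_add_arg del: free_algebra_simps(1))
  qed
qed

lemma act_gen: "x \<in> carrier L \<Longrightarrow> v \<in> carrier V \<Longrightarrow> act (gen x) v = \<rho> x v"
  by (simp add: gen_def act_single one_scale rho_closed)

lemma act_const: "v \<in> carrier V \<Longrightarrow> act (const a) v = a \<odot>\<^bsub>V\<^esub> v"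
  by (simp add: const_def act_single)

lemma act_one: "v \<in> carrier V \<Longrightarrow> act 1 v = v"
  using act_const[of v 1] by (simp add: one_scale const_def flip: single_one zero_list_def)

lemma T_uminus: "f \<in> carrier T \<Longrightarrow> \<ominus>\<^bsub>T\<^esub> f = - f"
  by (rule T.minus_equality) auto

lemma gen_closed: "x \<in> carrier L \<Longrightarrow> gen x \<in> carrier T"
  by (simp add: gen_def)

lemma const_closed: "const a \<in> carrier T"
  by (simp add: const_def)

lemma diff_closed: "f \<in> carrier T \<Longrightarrow> g \<in> carrier T \<Longrightarrow> f - g \<in> carrier T"
  using T.minus_closed[of f g] by (simp add: a_minus_def T_uminus)

lemma T_closed:
  assumes "f \<in> carrier T" "g \<in> carrier T" shows "f + g \<in> carrier T" "f * g \<in> carrier T"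
  using T.a_closed[OF assms] T.m_closed[OF assms] by simp_all

lemma act_diff_eq_zero:
  assumes "f \<in> carrier T" "g \<in> carrier T" "v \<in> carrier V" "act f v = act g v"
  shows "act (f - g) v = \<zero>\<^bsub>V\<^esub>"
  using act_sum[OF assms(1) _ assms(3), of "- g"] act_uminus[OF assms(2,3)] assms
  by (simp add: V.r_neg act_closed del: free_algebra_simps(1)) auto

interpretation I: ideal "env_ideal L" T
  by (intro ideal_env_ideal add_closed smult_closed bracket_closed)

text \<open>The polynomials that act as zero form the kernel of a ring homomorphism into the operators on \<open>V\<close>,
hence an ideal.\<close>

lemma ideal_annihilator: "ideal {f \<in> carrier T. \<forall>v\<in>carrier V. act f v = \<zero>\<^bsub>V\<^esub>} T"
  (is "ideal ?K T")
proof (rule idealI)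
  show "ring T" by (rule T.ring_axioms)
  show "subgroup ?K (add_monoid T)"
  proof
    show "inv\<^bsub>add_monoid T\<^esub> f \<in> ?K" if "f \<in> ?K" for f
    proof -
      have "inv\<^bsub>add_monoid T\<^esub> f = - f"
        using that T_uminus[of f] by (simp add: a_inv_def)
      then show ?thesis
        using that T.a_inv_closed[of f] T_uminus[of f] act_uminus[of f]
        by (auto simp del: free_algebra_simps(1))
    qed
  qed (auto simp del: free_algebra_simps(1) simp: act_sum T_closed T.zero_closed[simplified])
next
  fix f g assume "f \<in> ?K" "g \<in> carrier T"
  then show "g \<otimes>\<^bsub>T\<^esub> f \<in> ?K" "f \<otimes>\<^bsub>T\<^esub> g \<in> ?K"
    by (auto simp del: free_algebra_simps(1) simp: T_closed act_mult act_zero_arg act_closed)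
qed

text \<open>The relations act as zero because \<open>\<rho>\<close> is a representation, and \<open>env_ideal L\<close> is the smallest ideal
that contains them.\<close>

lemma env_ideal_acts_trivially:
  assumes "f \<in> env_ideal L" "v \<in> carrier V"
  shows "act f v = \<zero>\<^bsub>V\<^esub>"
proof -
  let ?K = "{f \<in> carrier T. \<forall>v\<in>carrier V. act f v = \<zero>\<^bsub>V\<^esub>}"
  note [simp del] = free_algebra_simps(1)
  note [simp] = gen_closed const_closed diff_closed T_closed act_gen act_const act_mult act_sum
    rho_closed scale_closed add_closed smult_closed bracket_closed
  have "env_relations L \<subseteq> ?K"
  proof -
    have "gen (x \<oplus>\<^bsub>L\<^esub> y) - (gen x + gen y) \<in> ?K"
      if "x \<in> carrier L" "y \<in> carrier L" for x y
      using that by (auto intro!: act_diff_eq_zero simp: add_rho)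
    moreover have "gen (a \<odot>\<^bsub>L\<^esub> x) - const a * gen x \<in> ?K" if "x \<in> carrier L" for a x
      using that by (auto intro!: act_diff_eq_zero simp: smult_rho)
    moreover have "gen x * gen y - gen y * gen x - gen (x \<otimes>\<^bsub>L\<^esub> y) \<in> ?K"
      if "x \<in> carrier L" "y \<in> carrier L" for x y
    proof -
      have "act (gen x * gen y - (gen (x \<otimes>\<^bsub>L\<^esub> y) + gen y * gen x)) v = \<zero>\<^bsub>V\<^esub>"
        if v: "v \<in> carrier V" for v
        using that \<open>x \<in> carrier L\<close> \<open>y \<in> carrier L\<close>
        by (intro act_diff_eq_zero) (simp_all add: bracket_rho)
      then show ?thesis
        using that by (simp add: algebra_simps)
    qed
    ultimately show ?thesis unfolding env_relations_def by blast
  qed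
  from T.genideal_minimal[OF ideal_annihilator this] show ?thesis
    using assms unfolding env_ideal_def by blast
qed

lemma env_action_coset:
  assumes "f \<in> carrier T" "v \<in> carrier V"
  shows "env_action V \<rho> (env_ideal L +>\<^bsub>T\<^esub> f) v = act f v"
proof -
  have "act (h + f) v = act f v" if "h \<in> env_ideal L" for h
    using that I.a_Hcarr[OF that] assms
    by (simp add: act_sum env_ideal_acts_trivially act_closed del: free_algebra_simps(1))
  then have "(\<lambda>f. act f v) ` (env_ideal L +>\<^bsub>T\<^esub> f) = {act f v}"
    using I.a_rcos_self[OF assms(1)] by (auto simp: a_r_coset_def r_coset_def)
  then show ?thesis
    by (simp add: env_action_def act_def)
qed

end

section \<open>Powers of a matrix over a noncommutative ring\<close>

lemma sum_lists_Suc: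
  assumes "finite A"
  shows "(\<Sum>xs\<in>{xs. length xs = Suc p \<and> set xs \<subseteq> A}. f xs) =
    (\<Sum>x\<in>A. \<Sum>xs\<in>{xs. length xs = p \<and> set xs \<subseteq> A}. f (x # xs))"
proof -
  have "{xs. length xs = Suc p \<and> set xs \<subseteq> A} =
      (\<lambda>(x, xs). x # xs) ` (A \<times> {xs. length xs = p \<and> set xs \<subseteq> A})"
    by (auto simp: length_Suc_conv image_iff)
  then show ?thesis
    by (simp add: sum.reindex inj_on_def sum.cartesian_product case_prod_beta)
qed

text \<open>The \<open>(i, j)\<close> entry of the \<open>p\<close>-th power of the matrix \<open>z\<close> with rows and columns indexed by \<open>A\<close>,
written as a sum of products along paths of length \<open>p\<close> from \<open>i\<close> to \<open>j\<close>. Exponent \<open>0\<close> gives the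
identity matrix, from which all inductions start.\<close>

primrec path_sum :: "('i \<Rightarrow> 'i \<Rightarrow> 'a::semiring_1) \<Rightarrow> 'i set \<Rightarrow> nat \<Rightarrow> 'i \<Rightarrow> 'i \<Rightarrow> 'a" where
  "path_sum z A 0 i j = of_bool (i = j)"
| "path_sum z A (Suc p) i j = (\<Sum>m\<in>A. z i m * path_sum z A p m j)"

text \<open>The list \<open>js\<close> holds the inner vertices of a path from \<open>i\<close> to \<open>j\<close>. A path of length \<open>p + 1\<close> has \<open>p\<close> of
them.\<close>

lemma path_sum_eq_sum_lists:
  assumes "finite A" "j \<in> A"
  shows "path_sum z A (Suc p) i j =
    (\<Sum>js\<in>{js. length js = p \<and> set js \<subseteq> A}. prod_list (map2 z (i # js) (js @ [j])))"
proof (induction p arbitrary: i)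
  case 0
  have "{js. js = [] \<and> set js \<subseteq> A} = {[]}" by auto
  then show ?case using assms by (simp add: of_bool_def if_distrib[of "\<lambda>x. _ * x"] sum.delta cong: if_cong)
next
  case (Suc p)
  show ?case
    by (subst path_sum.simps, subst Suc.IH, subst sum_lists_Suc[OF assms(1)])
      (simp add: sum_distrib_left)
qed

text \<open>Closed paths: their products sum to the trace of the \<open>p\<close>-th power. The cyclic successor of a
position is the same position in the list rotated by one, which turns the product over positions into
a product over a zipped list.\<close>

lemma sum_cyclic_products:
  assumes "finite A" "p \<noteq> 0"
  shows "(\<Sum>js\<in>{js. length js = p \<and> set js \<subseteq> A}.
      foldr (\<lambda>m u. z (js ! m) (js ! (Suc m mod p)) * u) [0..<p] 1) = (\<Sum>i\<in>A. path_sum z A p i i)"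
proof -
  obtain q where p: "p = Suc q" using assms(2) not0_implies_Suc by blast
  have "foldr (\<lambda>m u. z (js ! m) (js ! (Suc m mod p)) * u) [0..<p] 1 =
      prod_list (map2 z js (rotate1 js))" if "length js = p" for js
  proof -
    have "map2 z js (rotate1 js) = map (\<lambda>m. z (js ! m) (js ! (Suc m mod p))) [0..<p]"
      using that by (intro nth_equalityI) (auto simp: nth_rotate1)
    then show ?thesis
      by (simp add: prod_list.eq_foldr foldr_map comp_def)
  qed
  then have "(\<Sum>js\<in>{js. length js = p \<and> set js \<subseteq> A}.
      foldr (\<lambda>m u. z (js ! m) (js ! (Suc m mod p)) * u) [0..<p] 1) =
      (\<Sum>js\<in>{js. length js = p \<and> set js \<subseteq> A}. prod_list (map2 z js (rotate1 js)))"
    by (intro sum.cong) auto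
  also have "\<dots> = (\<Sum>i\<in>A. path_sum z A p i i)"
    unfolding p using assms(1)
    by (subst sum_lists_Suc) (auto simp: path_sum_eq_sum_lists simp del: path_sum.simps intro!: sum.cong)
  finally show ?thesis .
qed

lemma path_sum_closed:
  assumes "\<And>i j. i \<in> A \<Longrightarrow> j \<in> A \<Longrightarrow> z i j \<in> carrier (free_algebra S)" "i \<in> A" "j \<in> A"
  shows "path_sum z A p i j \<in> carrier (free_algebra S)"
  using assms(2)
proof (induction p arbitrary: i)
  case (Suc p)
  then show ?case
    using assms unfolding path_sum.simps by (intro free_algebra_sum_closed free_algebra_mult_closed)
qed (simp add: zero_list_def)

text \<open>If the commutator with \<open>g\<close> acts on the entries of a matrix \<open>Z\<close> as the commutator of matrices
\<open>m\<^sup>T Z - Z m\<^sup>T\<close>, then it acts so on the entries of every power of \<open>Z\<close>, because both sides are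
derivations. Here \<open>m\<close> has central entries, and the hypothesis and conclusion are congruences modulo
\<open>I\<close>.\<close>

lemma commutator_path_sum:
  fixes z :: "'i \<Rightarrow> 'i \<Rightarrow> ('x list \<Rightarrow>\<^sub>0 'f::field)" and m :: "'i \<Rightarrow> 'i \<Rightarrow> ('x list \<Rightarrow>\<^sub>0 'f)"
  assumes I: "ideal I (free_algebra S)" and "finite A"
    and z: "\<And>i j. i \<in> A \<Longrightarrow> j \<in> A \<Longrightarrow> z i j \<in> carrier (free_algebra S)"
    and central: "\<And>a b f. m a b * f = f * m a b"
    and comm: "\<And>i j. i \<in> A \<Longrightarrow> j \<in> A \<Longrightarrow>
      g * z i j - z i j * g - ((\<Sum>a\<in>A. m a i * z a j) - (\<Sum>b\<in>A. m j b * z i b)) \<in> I"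
    and ij: "i \<in> A" "j \<in> A"
  shows "g * path_sum z A p i j - path_sum z A p i j * g -
    ((\<Sum>a\<in>A. m a i * path_sum z A p a j) - (\<Sum>b\<in>A. m j b * path_sum z A p i b)) \<in> I"
  using ij(1)
proof (induction p arbitrary: i)
  case 0
  then show ?case
    using ij(2) assms(2) free_algebra_ideal_closed(1)[OF I]
    by (simp add: of_bool_def if_distrib[of "\<lambda>x. _ * x"] if_distrib[of "\<lambda>x. x * _"]
        sum.delta cong: if_cong)
next
  case (Suc p)
  let ?P = "path_sum z A p"
  let ?q = "\<lambda>i j. (\<Sum>a\<in>A. m a i * z a j) - (\<Sum>b\<in>A. m j b * z i b)"
  let ?Q = "\<lambda>i j. (\<Sum>a\<in>A. m a i * ?P a j) - (\<Sum>b\<in>A. m j b * ?P i b)"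
  have central': "z i n * (m a b * f) = m a b * (z i n * f)" for a b n i f
    unfolding mult.assoc[symmetric] central[of a b "z i n"] ..
  \<comment> \<open>In the Leibniz rule for \<open>z i n * P n j\<close> the second part of the first factor's commutator and the
    first part of the second factor's commutator cancel after summation over \<open>n\<close>.\<close>
  have middle: "(\<Sum>n\<in>A. \<Sum>b\<in>A. m n b * (z i b * ?P n j)) = (\<Sum>n\<in>A. \<Sum>a\<in>A. m a n * (z i n * ?P a j))"
    by (rule sum.swap)
  have first: "(\<Sum>a\<in>A. \<Sum>n\<in>A. m a i * (z a n * ?P n j)) = (\<Sum>n\<in>A. \<Sum>a\<in>A. m a i * (z a n * ?P n j))"
    by (rule sum.swap)
  have last: "(\<Sum>b\<in>A. \<Sum>n\<in>A. m j b * (z i n * ?P n b)) = (\<Sum>n\<in>A. \<Sum>b\<in>A. m j b * (z i n * ?P n b))"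
    by (rule sum.swap)
  have split: "(\<Sum>n\<in>A. ?q i n * ?P n j + z i n * ?Q n j) =
      (\<Sum>a\<in>A. m a i * path_sum z A (Suc p) a j) - (\<Sum>b\<in>A. m j b * path_sum z A (Suc p) i b)"
    by (simp add: first last left_diff_distrib right_diff_distrib sum_distrib_left sum_distrib_right
        sum.distrib sum_subtractf mult.assoc central' middle)
  have regroup: "g * (x * y) - x * y * g - (q * y + x * r) =
      (g * x - x * g - q) * y + x * (g * y - y * g - r)" for x y q r
    by (simp add: algebra_simps)
  have "g * path_sum z A (Suc p) i j - path_sum z A (Suc p) i j * g -
      (\<Sum>n\<in>A. ?q i n * ?P n j + z i n * ?Q n j) =
      (\<Sum>n\<in>A. g * (z i n * ?P n j) - z i n * ?P n j * g - (?q i n * ?P n j + z i n * ?Q n j))"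
    by (simp only: path_sum.simps sum_distrib_left[of g] sum_distrib_right[of _ _ g] sum_subtractf)
  also have "\<dots> = (\<Sum>n\<in>A. (g * z i n - z i n * g - ?q i n) * ?P n j +
      z i n * (g * ?P n j - ?P n j * g - ?Q n j))"
    unfolding regroup ..
  also have "\<dots> \<in> I"
  proof (rule free_algebra_ideal_sum_closed[OF I])
    fix n assume n: "n \<in> A"
    note P = path_sum_closed[of A z, OF z n ij(2), of p]
    have "(g * z i n - z i n * g - ?q i n) * ?P n j \<in> I"
      using free_algebra_ideal_closed(3)[OF I comm[OF Suc.prems n] P] .
    moreover have "z i n * (g * ?P n j - ?P n j * g - ?Q n j) \<in> I"
      using free_algebra_ideal_closed(4)[OF I Suc.IH[OF n] z[OF Suc.prems n]] .
    ultimately show "(g * z i n - z i n * g - ?q i n) * ?P n j +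
        z i n * (g * ?P n j - ?P n j * g - ?Q n j) \<in> I"
      using free_algebra_ideal_closed(2)[OF I] by simp
  qed
  finally show ?case unfolding split .
qed

text \<open>The trace of a commutator of matrices vanishes as soon as the entries of one of them are central.\<close>

lemma commutator_trace_path_sum:
  fixes z :: "'i \<Rightarrow> 'i \<Rightarrow> ('x list \<Rightarrow>\<^sub>0 'f::field)" and m :: "'i \<Rightarrow> 'i \<Rightarrow> ('x list \<Rightarrow>\<^sub>0 'f)"
  assumes I: "ideal I (free_algebra S)" and "finite A"
    and z: "\<And>i j. i \<in> A \<Longrightarrow> j \<in> A \<Longrightarrow> z i j \<in> carrier (free_algebra S)"
    and central: "\<And>a b f. m a b * f = f * m a b"
    and comm: "\<And>i j. i \<in> A \<Longrightarrow> j \<in> A \<Longrightarrow>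
      g * z i j - z i j * g - ((\<Sum>a\<in>A. m a i * z a j) - (\<Sum>b\<in>A. m j b * z i b)) \<in> I"
  shows "g * (\<Sum>i\<in>A. path_sum z A p i i) - (\<Sum>i\<in>A. path_sum z A p i i) * g \<in> I"
proof -
  let ?P = "path_sum z A p"
  have "(\<Sum>i\<in>A. \<Sum>a\<in>A. m a i * ?P a i) = (\<Sum>i\<in>A. \<Sum>b\<in>A. m i b * ?P i b)"
    by (rule sum.swap)
  then have "g * (\<Sum>i\<in>A. ?P i i) - (\<Sum>i\<in>A. ?P i i) * g =
      (\<Sum>i\<in>A. g * ?P i i - ?P i i * g - ((\<Sum>a\<in>A. m a i * ?P a i) - (\<Sum>b\<in>A. m i b * ?P i b)))"
    by (simp add: sum_subtractf sum_distrib_left sum_distrib_right)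
  also have "\<dots> \<in> I"
    by (intro free_algebra_ideal_sum_closed[OF I] commutator_path_sum[OF assms])
  finally show ?thesis .
qed

section \<open>The adjoint representation of sl\<close>

lemma sl_simps:
  "A \<in> carrier (sl k) \<longleftrightarrow> A \<in> carrier_mat k k \<and> (\<Sum>i<k. A $$ (i, i)) = 0"
  "A \<otimes>\<^bsub>sl k\<^esub> B = A * B - B * A" "A \<oplus>\<^bsub>sl k\<^esub> B = A + B" "\<zero>\<^bsub>sl k\<^esub> = 0\<^sub>m k k" "a \<odot>\<^bsub>sl k\<^esub> A = a \<cdot>\<^sub>m A"
  by (simp_all add: sl_def)

lemma abelian_group_sl: "abelian_group (sl k :: ('f::field, 'f mat) module)"
proof (rule abelian_groupI)
  fix A :: "'f mat" assume "A \<in> carrier (sl k)"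
  then show "\<exists>B\<in>carrier (sl k). B \<oplus>\<^bsub>sl k\<^esub> A = \<zero>\<^bsub>sl k\<^esub>"
    by (intro bexI[of _ "- A"]) (auto simp: sl_simps sum_negf)
qed (auto simp: sl_simps sum.distrib intro: assoc_add_mat comm_add_mat)

text \<open>The second product is written with its factors exchanged, so that in both sums the entry of \<open>A\<close>
comes first. For the sparse matrix \<open>x\<^sub>i\<^sub>j\<close> in the role of \<open>A\<close> both sums then collapse in the same way.\<close>

lemma bracket_entry:
  fixes A B :: "'f::field mat"
  assumes "A \<in> carrier_mat k k" "B \<in> carrier_mat k k" "r < k" "s < k"
  shows "(A * B - B * A) $$ (r, s) =
    (\<Sum>t<k. A $$ (r, t) * B $$ (t, s)) - (\<Sum>t<k. A $$ (t, s) * B $$ (r, t))"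
  using assms by (simp add: scalar_prod_def atLeast0LessThan mult.commute)

text \<open>The Jacobi identity, in the form required of a representation.\<close>

lemma jacobi_matrix:
  fixes A B C :: "'f::field mat"
  assumes "A \<in> carrier_mat k k" "B \<in> carrier_mat k k" "C \<in> carrier_mat k k"
  shows "((A * B - B * A) * C - C * (A * B - B * A)) + (B * (A * C - C * A) - (A * C - C * A) * B) =
    A * (B * C - C * B) - (B * C - C * B) * A"
  using assms
  by (intro eq_matI) (auto simp: mult_minus_distrib_mat[of _ k k _ k] minus_mult_distrib_mat[of _ k k _ _ k]
      assoc_mult_mat[of _ k k _ k _ k])

lemma lie_representation_sl_adjoint:
  "lie_representation (sl k) (sl k :: ('f::field, 'f mat) module) (adjoint (sl k))"
proof -
  interpret abelian_group "sl k :: ('f, 'f mat) module" by (rule abelian_group_sl)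
  show ?thesis
  proof
    fix A B C :: "'f mat" and a b :: 'f
    assume A: "A \<in> carrier (sl k)"
    then have A': "A \<in> carrier_mat k k" by (simp add: sl_simps)
    show "a \<odot>\<^bsub>sl k\<^esub> A \<in> carrier (sl k)" using A by (rule sl_closed)
    show "(a + b) \<odot>\<^bsub>sl k\<^esub> A = a \<odot>\<^bsub>sl k\<^esub> A \<oplus>\<^bsub>sl k\<^esub> b \<odot>\<^bsub>sl k\<^esub> A"
      by (simp add: sl_simps add_smult_distrib_right_mat[OF A'])
    show "a \<odot>\<^bsub>sl k\<^esub> (b \<odot>\<^bsub>sl k\<^esub> A) = (a * b) \<odot>\<^bsub>sl k\<^esub> A" "1 \<odot>\<^bsub>sl k\<^esub> A = A"
      by (auto simp: sl_simps intro!: eq_matI)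
    assume B: "B \<in> carrier (sl k)"
    then have B': "B \<in> carrier_mat k k" by (simp add: sl_simps)
    show "A \<oplus>\<^bsub>sl k\<^esub> B \<in> carrier (sl k)" "A \<otimes>\<^bsub>sl k\<^esub> B \<in> carrier (sl k)"
      "adjoint (sl k) A B \<in> carrier (sl k)"
      using sl_closed[OF A] B by (auto simp: adjoint_def)
    show "a \<odot>\<^bsub>sl k\<^esub> (A \<oplus>\<^bsub>sl k\<^esub> B) = a \<odot>\<^bsub>sl k\<^esub> A \<oplus>\<^bsub>sl k\<^esub> a \<odot>\<^bsub>sl k\<^esub> B"
      using A' B' by (simp add: sl_simps add_smult_distrib_left_mat)
    show "adjoint (sl k) A (a \<odot>\<^bsub>sl k\<^esub> B) = a \<odot>\<^bsub>sl k\<^esub> adjoint (sl k) A B"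
      "adjoint (sl k) (a \<odot>\<^bsub>sl k\<^esub> A) B = a \<odot>\<^bsub>sl k\<^esub> adjoint (sl k) A B"
      using A' B' by (auto simp: sl_simps adjoint_def mult_smult_distrib mult_smult_assoc_mat
          right_diff_distrib intro!: eq_matI)
    assume C: "C \<in> carrier (sl k)"
    then have C': "C \<in> carrier_mat k k" by (simp add: sl_simps)
    show "adjoint (sl k) A (B \<oplus>\<^bsub>sl k\<^esub> C) = adjoint (sl k) A B \<oplus>\<^bsub>sl k\<^esub> adjoint (sl k) A C"
      using A' B' C' by (intro eq_matI) (auto simp: sl_simps adjoint_def mult_add_distrib_mat[of _ k k _ k] add_mult_distrib_mat[of _ k k _ _ k])
    show "adjoint (sl k) (A \<oplus>\<^bsub>sl k\<^esub> B) C = adjoint (sl k) A C \<oplus>\<^bsub>sl k\<^esub> adjoint (sl k) B C"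
      using A' B' C' by (intro eq_matI) (auto simp: sl_simps adjoint_def mult_add_distrib_mat[of _ k k _ k] add_mult_distrib_mat[of _ k k _ _ k])
    show "adjoint (sl k) (A \<otimes>\<^bsub>sl k\<^esub> B) C \<oplus>\<^bsub>sl k\<^esub> adjoint (sl k) B (adjoint (sl k) A C) =
        adjoint (sl k) A (adjoint (sl k) B C)"
      using jacobi_matrix[OF A' B' C'] by (simp add: sl_simps adjoint_def)
  qed
qed

interpretation ad: lie_representation "sl k" "sl k" "adjoint (sl k)" for k
  by (rule lie_representation_sl_adjoint)

lemma finsum_sl_entry:
  fixes f :: "'i \<Rightarrow> 'f::field mat"
  assumes "finite A" "\<And>i. i \<in> A \<Longrightarrow> f i \<in> carrier (sl k)" "r < k" "s < k"
  shows "finsum (sl k) f A $$ (r, s) = (\<Sum>i\<in>A. f i $$ (r, s))"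
proof -
  show ?thesis
    using assms(1,2)
  proof (induction A rule: finite_induct)
    case empty
    then show ?case using assms by (simp add: sl_simps)
  next
    case (insert i A)
    then have "finsum (sl k) f A \<in> carrier (sl k)" by (intro ad.V.finsum_closed) auto
    then have "finsum (sl k) f A \<in> carrier_mat k k" by (simp add: sl_simps)
    with insert show ?case using assms by (simp add: ad.V.finsum_insert Pi_def sl_simps(3))
  qed
qed

lemma matrix_unit_carrier [simp]: "matrix_unit k i j \<in> carrier_mat k k"
  by (simp add: matrix_unit_def)

lemma sl_h_closed: "l \<in> {1..<k} \<Longrightarrow> (sl_h k l :: 'a::field mat) \<in> carrier (sl k)"
proof -
  assume l: "l \<in> {1..<k}"
  then have "(\<Sum>i<k. (sl_h k l :: 'a mat) $$ (i, i)) =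
      (\<Sum>i<k. (if i = l - 1 then 1 else 0) - (if i = l then 1 else 0))"
    by (intro sum.cong) (auto simp: sl_h_def matrix_unit_def)
  also have "\<dots> = 0" using l by (auto simp: sum_subtractf)
  finally show ?thesis by (simp add: sl_simps) (simp add: sl_h_def minus_carrier_mat)
qed

text \<open>On the diagonal, \<open>h\<^sub>l\<close> has entry \<open>1\<close> at position \<open>l\<close> and \<open>- 1\<close> at position \<open>l + 1\<close>, so the sum of
the \<open>\<alpha>\<^sub>i\<^sub>l h\<^sub>l\<close> has as diagonal entries the differences of consecutive \<open>\<alpha>\<^sub>i\<^sub>l\<close>. These are \<open>k - 1\<close> at
position \<open>i\<close> and \<open>- 1\<close> elsewhere, also at the two ends, because the formula for \<open>\<alpha>\<^sub>i\<^sub>l\<close> gives \<open>0\<close> for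
\<open>l = 0\<close> and \<open>l = k\<close>. Hence \<open>x\<^sub>i\<^sub>i\<close> is \<open>e\<^sub>i\<^sub>i\<close> minus \<open>1/k\<close> times the identity matrix.\<close>

lemma sl_x_entry:
  assumes "i < k" "j < k" "r < k" "s < k"
  shows "(sl_x k (Suc i) (Suc j) :: 'f::field_char_0 mat) $$ (r, s) =
    of_bool (r = i \<and> s = j) - of_bool (i = j \<and> r = s) / of_nat k"
proof (cases "i = j")
  case False
  then show ?thesis using assms by (auto simp: sl_x_def matrix_unit_def)
next
  case True
  let ?\<alpha> = "sl_alpha k (Suc i) :: nat \<Rightarrow> 'f"
  have closed: "?\<alpha> l \<odot>\<^bsub>sl k\<^esub> sl_h k l \<in> carrier (sl k)" if "l \<in> {1..<k}" for l
    using that by (intro sl_closed sl_h_closed)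
  let ?S = "\<Oplus>\<^bsub>sl k\<^esub>l\<in>{1..<k}. ?\<alpha> l \<odot>\<^bsub>sl k\<^esub> sl_h k l"
  have S: "?S \<in> carrier (sl k)" using closed by (intro ad.V.finsum_closed) auto
  have "?S $$ (r, s) = (\<Sum>l\<in>{1..<k}. (?\<alpha> l \<odot>\<^bsub>sl k\<^esub> sl_h k l) $$ (r, s))"
    using assms closed by (intro finsum_sl_entry) auto
  also have "\<dots> = (\<Sum>l\<in>{1..<k}. if r = s then (if l = Suc r then ?\<alpha> l else 0) - (if l = r then ?\<alpha> l else 0) else 0)"
    using assms by (intro sum.cong) (auto simp: sl_simps(5) sl_h_def matrix_unit_def)
  also have "\<dots> = (if r = s then ?\<alpha> (Suc r) - ?\<alpha> r else 0)"
    using assms by (cases "k = Suc r") (auto simp: sum_subtractf sl_alpha_def)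
  finally show ?thesis
    using True S assms
    by (auto simp: sl_x_def sl_simps sl_alpha_def divide_simps)
qed

lemma sl_x_closed:
  assumes "i \<in> {1..k}" "j \<in> {1..k}"
  shows "(sl_x k i j :: 'f::field_char_0 mat) \<in> carrier (sl k)"
proof (cases "i = j")
  case True
  show ?thesis
    using True unfolding sl_x_def
    by (auto intro!: sl_closed ad.V.finsum_closed sl_h_closed)
next
  case False
  then show ?thesis by (auto simp: sl_x_def sl_simps matrix_unit_def intro!: sum.neutral)
qed

text \<open>Scalar matrices bracket to zero, so \<open>x\<^sub>i\<^sub>j\<close> acts as the matrix unit: \<open>Y\<close> is mapped to
\<open>e\<^sub>i\<^sub>j Y - Y e\<^sub>i\<^sub>j\<close>.\<close>

lemma adjoint_sl_x_entry:
  fixes Y :: "'f::field_char_0 mat"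
  assumes "i < k" "j < k" "r < k" "s < k" "Y \<in> carrier (sl k)"
  shows "adjoint (sl k) (sl_x k (Suc i) (Suc j)) Y $$ (r, s) =
    of_bool (r = i) * Y $$ (j, s) - of_bool (s = j) * Y $$ (r, i)"
proof -
  have Y: "Y \<in> carrier_mat k k" using assms by (simp add: sl_simps)
  have X: "(sl_x k (Suc i) (Suc j) :: 'f mat) \<in> carrier_mat k k"
    using sl_x_closed[where 'f='f, of "Suc i" k "Suc j"] assms by (simp add: sl_simps)
  show ?thesis
    unfolding adjoint_def sl_simps bracket_entry[OF X Y assms(3,4)]
    using assms(1-4)
    by (cases "i = j") (simp_all add: sl_x_entry left_diff_distrib sum_subtractf of_bool_conj
        if_distrib[of "\<lambda>x. x * _"] sum_divide_distrib[symmetric] of_bool_def cong: if_cong)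
qed

section \<open>Casimir elements as traces of matrix powers\<close>

abbreviation sl_act :: "nat \<Rightarrow> ('f::field mat list \<Rightarrow>\<^sub>0 'f) \<Rightarrow> 'f mat \<Rightarrow> 'f mat" where
  "sl_act k \<equiv> lie_representation.act (sl k) (adjoint (sl k))"

abbreviation sl_gen :: "nat \<Rightarrow> nat \<Rightarrow> nat \<Rightarrow> ('f::field mat list \<Rightarrow>\<^sub>0 'f)" where
  "sl_gen k i j \<equiv> gen (sl_x k i j)"

abbreviation sl_path_sum :: "nat \<Rightarrow> nat \<Rightarrow> nat \<Rightarrow> nat \<Rightarrow> ('f::field mat list \<Rightarrow>\<^sub>0 'f)" where
  "sl_path_sum k \<equiv> path_sum (sl_gen k) {1..k}"

lemma sl_gen_closed:
  "i \<in> {1..k} \<Longrightarrow> j \<in> {1..k} \<Longrightarrow> (sl_gen k i j :: 'f::field_char_0 mat list \<Rightarrow>\<^sub>0 'f) \<in> carrier (free_algebra (carrier (sl k)))"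
  by (intro ad.gen_closed sl_x_closed)

text \<open>A representative of the Casimir element in the free algebra: the trace of the \<open>p\<close>-th power of the
matrix of generators.\<close>

definition casimir_poly :: "nat \<Rightarrow> nat \<Rightarrow> ('f::field mat list \<Rightarrow>\<^sub>0 'f)" where
  "casimir_poly p k = (\<Sum>i\<in>{1..k}. sl_path_sum k p i i)"

lemma casimir_poly_closed:
  "(casimir_poly p k :: 'f::field_char_0 mat list \<Rightarrow>\<^sub>0 'f) \<in> carrier (free_algebra (carrier (sl k)))"
  unfolding casimir_poly_def by (intro free_algebra_sum_closed path_sum_closed sl_gen_closed)

lemma casimir_eq_coset:
  assumes "p \<noteq> 0"
  shows "(casimir p k :: ('f::field_char_0 mat list \<Rightarrow>\<^sub>0 'f) set) =
    env_ideal (sl k) +>\<^bsub>free_algebra (carrier (sl k))\<^esub> casimir_poly p k"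
proof -
  let ?A = "{is. length is = p \<and> set is \<subseteq> {1..k}}"
  let ?I = "env_ideal (sl k :: ('f, 'f mat) module)"
  let ?F = "free_algebra (carrier (sl k)) :: ('f mat list \<Rightarrow>\<^sub>0 'f) ring"
  let ?x = "\<lambda>is m. sl_gen k (is ! m) (is ! (Suc m mod p)) :: 'f mat list \<Rightarrow>\<^sub>0 'f"
  let ?w = "\<lambda>is. foldr (\<lambda>m u. ?x is m * u) [0..<p] 1"
  have I: "ideal ?I ?F" by (intro ideal_env_ideal sl_closed)
  have x: "?x is m \<in> carrier ?F" if "is \<in> ?A" "m \<in> set [0..<p]" for "is" m
  proof -
    have "is ! m \<in> set is" "is ! (Suc m mod p) \<in> set is" "set is \<subseteq> {1..k}"
      using that assms by (auto intro!: nth_mem)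
    then show ?thesis by (intro sl_gen_closed) blast+
  qed
  have w: "?w is \<in> carrier ?F" if "is \<in> ?A" for "is"
    by (intro coset_foldr(1)[OF I] x that)
  have fin: "finite ?A"
    using finite_lists_length_eq[of "{1..k}" p] by (simp add: conj_commute)
  interpret Q: ring "?F Quot ?I" by (rule ideal.quotient_is_ring[OF I])
  have "(casimir p k :: ('f mat list \<Rightarrow>\<^sub>0 'f) set) = (\<Oplus>\<^bsub>?F Quot ?I\<^esub>is\<in>?A.
      foldr (\<lambda>m u. (?I +>\<^bsub>?F\<^esub> ?x is m) \<otimes>\<^bsub>?F Quot ?I\<^esub> u) [0..<p] \<one>\<^bsub>?F Quot ?I\<^esub>)"
    by (simp add: casimir_def univ_env_def env_inj_def)
  also have "\<dots> = (\<Oplus>\<^bsub>?F Quot ?I\<^esub>is\<in>?A. ?I +>\<^bsub>?F\<^esub> ?w is)"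
  proof (rule Q.finsum_cong'[OF refl])
    show "(\<lambda>is. ?I +>\<^bsub>?F\<^esub> ?w is) \<in> ?A \<rightarrow> carrier (?F Quot ?I)"
      by (intro Pi_I ring_hom_closed[OF ideal.rcos_ring_hom[OF I]] w)
  qed (intro coset_foldr(2)[OF I] x)
  also have "\<dots> = ?I +>\<^bsub>?F\<^esub> (\<Sum>is\<in>?A. ?w is)"
    by (intro coset_finsum I fin w)
  also have "(\<Sum>is\<in>?A. ?w is) = casimir_poly p k"
    unfolding casimir_poly_def by (rule sum_cyclic_products) (use assms in auto)
  finally show ?thesis .
qed

section \<open>The scalar by which a Casimir element acts\<close>

lemma sl_act_sum_entry:
  assumes "Y \<in> carrier (sl k)" "r < k" "s < k"
    and "\<And>i. i \<in> A \<Longrightarrow> f i \<in> carrier (free_algebra (carrier (sl k)))"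
  shows "sl_act k (\<Sum>i\<in>A. f i) Y $$ (r, s) = (\<Sum>i\<in>A. sl_act k (f i) Y $$ (r, s))"
  using assms(4)
proof (induction A rule: infinite_finite_induct)
  case (insert i A)
  then have *: "f i \<in> carrier (free_algebra (carrier (sl k)))"
    "(\<Sum>i\<in>A. f i) \<in> carrier (free_algebra (carrier (sl k)))"
    by (auto intro!: free_algebra_sum_closed simp del: free_algebra_simps(1))
  then have "sl_act k (\<Sum>i\<in>A. f i) Y \<in> carrier_mat k k"
    using ad.act_closed[OF *(2) assms(1)] by (simp add: sl_simps)
  then show ?case
    using insert assms ad.act_sum[OF * assms(1)] by (simp add: sl_simps(3) del: free_algebra_simps(1))
qed (use assms in \<open>simp_all add: sl_simps(4)\<close>)

lemma sum_one_to: "(\<Sum>i\<in>{1..k}. f i) = (\<Sum>i<k. f (Suc i))"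
  by (simp add: sum.atLeast1_atMost_eq)

lemma sum_delta_mult:
  fixes f :: "nat \<Rightarrow> 'a::semiring_1"
  assumes "j < k"
  shows "(\<Sum>m<k. a * of_bool (m = j) * f m) = a * f j" "(\<Sum>m<k. a * of_bool (j = m) * f m) = a * f j"
proof -
  have "a * of_bool (m = j) * f m = (if m = j then a * f j else 0)" for m
    by simp
  then show "(\<Sum>m<k. a * of_bool (m = j) * f m) = a * f j"
    using assms by simp
  then show "(\<Sum>m<k. a * of_bool (j = m) * f m) = a * f j"
    by (simp only: eq_commute[of j])
qed

text \<open>The scalar by which \<open>e\<^sub>i\<^sub>j Y\<close> occurs in the image of \<open>Y\<close> under the \<open>(i, j)\<close> entry of the \<open>p\<close>-th power
of the matrix of generators.\<close>

primrec left_coeff :: "nat \<Rightarrow> nat \<Rightarrow> 'f::field" where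
  "left_coeff k 0 = 0"
| "left_coeff k (Suc p) = of_nat k * left_coeff k p + of_bool (even p)"

text \<open>The negative of the coefficient of \<open>Y\<^sub>j\<^sub>i 1\<close> in the same image. It lags one step behind
\<open>left_coeff\<close>, because this term arises from bracketing \<open>e\<^sub>m\<^sub>j Y\<close> with \<open>e\<^sub>i\<^sub>m\<close> and summing over \<open>m\<close>.\<close>

definition trace_coeff :: "nat \<Rightarrow> nat \<Rightarrow> 'f::field" where
  "trace_coeff k p = (case p of 0 \<Rightarrow> 0 | Suc q \<Rightarrow> left_coeff k q)"

text \<open>One more factor turns a family \<open>Z\<^sub>m\<^sub>j\<close> of images of \<open>Y\<close> into \<open>\<Sum>\<^sub>m [e\<^sub>i\<^sub>m, Z\<^sub>m\<^sub>j]\<close>. For the families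
\<open>e\<^sub>m\<^sub>j Y\<close>, \<open>Y e\<^sub>m\<^sub>j\<close>, \<open>\<delta>\<^sub>m\<^sub>j Y\<close> and \<open>Y\<^sub>j\<^sub>m 1\<close> the result is \<open>k e\<^sub>i\<^sub>j Y - Y\<^sub>j\<^sub>i 1\<close>,
\<open>tr(Y) e\<^sub>i\<^sub>j - \<delta>\<^sub>i\<^sub>j Y\<close>, \<open>e\<^sub>i\<^sub>j Y - Y e\<^sub>i\<^sub>j\<close> and \<open>0\<close>. Since \<open>tr Y = 0\<close>, linear combinations of the
four families are preserved, and the identity \<open>\<delta>\<^sub>i\<^sub>j Y\<close> at \<open>p = 0\<close> is one of them.\<close>

lemma sl_path_sum_act_entry:
  fixes Y :: "'f::field_char_0 mat"
  assumes Y: "Y \<in> carrier (sl k)" and "i < k" "j < k" "r < k" "s < k"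
  shows "sl_act k (sl_path_sum k p (Suc i) (Suc j)) Y $$ (r, s) =
    left_coeff k p * of_bool (r = i) * Y $$ (j, s) - of_bool (odd p) * of_bool (s = j) * Y $$ (r, i)
    + of_bool (even p) * of_bool (i = j) * Y $$ (r, s) - trace_coeff k p * of_bool (r = s) * Y $$ (j, i)"
  using assms(2,4,5)
proof (induction p arbitrary: i r s)
  case 0
  show ?case
    using 0 ad.act_one[OF Y] Y by (auto simp: trace_coeff_def sl_simps(4))
next
  case (Suc p)
  have trace: "(\<Sum>m<k. Y $$ (m, m)) = 0" using Y by (simp add: sl_simps)
  have path: "sl_path_sum k p (Suc m) (Suc j) \<in> carrier (free_algebra (carrier (sl k :: ('f, 'f mat) module)))"
    if "m < k" for m
    using that assms(3) by (intro path_sum_closed sl_gen_closed) auto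
  let ?Z = "\<lambda>m. sl_act k (sl_path_sum k p (Suc m) (Suc j)) Y"
  have gen: "(sl_gen k (Suc i) (Suc m) :: 'f mat list \<Rightarrow>\<^sub>0 'f) \<in> carrier (free_algebra (carrier (sl k)))"
    if "m < k" for m
    using that Suc.prems by (intro sl_gen_closed) auto
  have "sl_act k (sl_path_sum k (Suc p) (Suc i) (Suc j)) Y $$ (r, s) =
      sl_act k (\<Sum>m<k. sl_gen k (Suc i) (Suc m) * sl_path_sum k p (Suc m) (Suc j)) Y $$ (r, s)"
    by (simp only: path_sum.simps sum_one_to)
  also have "\<dots> = (\<Sum>m<k. sl_act k (sl_gen k (Suc i) (Suc m) * sl_path_sum k p (Suc m) (Suc j)) Y $$ (r, s))"
    using Y Suc.prems gen path by (intro sl_act_sum_entry free_algebra_mult_closed) auto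
  also have "\<dots> = (\<Sum>m<k. adjoint (sl k) (sl_x k (Suc i) (Suc m)) (?Z m) $$ (r, s))"
  proof (intro sum.cong refl)
    fix m assume "m \<in> {..<k}"
    then have m: "m < k" by simp
    have x: "(sl_x k (Suc i) (Suc m) :: 'f mat) \<in> carrier (sl k)"
      using m Suc.prems by (intro sl_x_closed) auto
    show "sl_act k (sl_gen k (Suc i) (Suc m) * sl_path_sum k p (Suc m) (Suc j)) Y $$ (r, s) =
        adjoint (sl k) (sl_x k (Suc i) (Suc m)) (?Z m) $$ (r, s)"
      unfolding ad.act_mult[OF gen[OF m] path[OF m] Y] ad.act_gen[OF x ad.act_closed[OF path[OF m] Y]] ..
  qed
  also have "\<dots> = (\<Sum>m<k. of_bool (r = i) * ?Z m $$ (m, s) - of_bool (s = m) * ?Z m $$ (r, i))"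
    using Suc.prems Y path by (intro sum.cong adjoint_sl_x_entry ad.act_closed) auto
  also have "\<dots> = of_bool (r = i) * (\<Sum>m<k. ?Z m $$ (m, s)) - ?Z s $$ (r, i)"
    using sum_delta_mult(2)[OF Suc.prems(3), of 1 "\<lambda>m. ?Z m $$ (r, i)"]
    by (simp add: sum_subtractf sum_distrib_left)
  also have "(\<Sum>m<k. ?Z m $$ (m, s)) =
      (\<Sum>m<k. left_coeff k p * Y $$ (j, s) - of_bool (odd p) * of_bool (s = j) * Y $$ (m, m)
      + of_bool (even p) * of_bool (m = j) * Y $$ (m, s) - trace_coeff k p * of_bool (m = s) * Y $$ (j, m))"
    using Suc.IH Suc.prems by (intro sum.cong) auto
  also have "\<dots> = (of_nat k * left_coeff k p + of_bool (even p) - trace_coeff k p) * Y $$ (j, s)"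
    unfolding sum_subtractf sum.distrib sum_delta_mult(1)[OF assms(3)] sum_delta_mult(1)[OF Suc.prems(3)]
      sum_distrib_left[symmetric] trace
    by (simp add: algebra_simps)
  finally show ?case
    unfolding Suc.IH[OF Suc.prems(3,2,1)]
    by (simp add: trace_coeff_def algebra_simps del: path_sum.simps)
qed

definition casimir_scalar :: "nat \<Rightarrow> nat \<Rightarrow> 'f::field" where
  "casimir_scalar p k = left_coeff k p - of_bool (odd p) + of_nat k * of_bool (even p)"

text \<open>On the diagonal \<open>i = j\<close> the four terms of \<open>sl_path_sum_act_entry\<close> sum to \<open>a Y\<close>, \<open>- [p odd] Y\<close>,
\<open>k [p even] Y\<close> and a multiple of \<open>tr Y = 0\<close>.\<close>

lemma casimir_poly_act:
  fixes Y :: "'f::field_char_0 mat"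
  assumes Y: "Y \<in> carrier (sl k)"
  shows "sl_act k (casimir_poly p k) Y = casimir_scalar p k \<cdot>\<^sub>m Y"
proof (rule eq_matI)
  have Y': "Y \<in> carrier_mat k k" and trace: "(\<Sum>m<k. Y $$ (m, m)) = 0" using Y by (auto simp: sl_simps)
  have "sl_act k (casimir_poly p k) Y \<in> carrier (sl k)"
    by (rule ad.act_closed[OF casimir_poly_closed Y])
  then show "dim_row (sl_act k (casimir_poly p k) Y) = dim_row (casimir_scalar p k \<cdot>\<^sub>m Y)"
    "dim_col (sl_act k (casimir_poly p k) Y) = dim_col (casimir_scalar p k \<cdot>\<^sub>m Y)"
    using Y' by (auto simp: sl_simps)
  fix r s assume "r < dim_row (casimir_scalar p k \<cdot>\<^sub>m Y)" "s < dim_col (casimir_scalar p k \<cdot>\<^sub>m Y)"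
  then have rs: "r < k" "s < k" using Y' by auto
  have "sl_act k (casimir_poly p k) Y $$ (r, s) =
      (\<Sum>i<k. sl_act k (sl_path_sum k p (Suc i) (Suc i)) Y $$ (r, s))"
    unfolding casimir_poly_def sum_one_to
    by (intro sl_act_sum_entry path_sum_closed sl_gen_closed) (use Y rs in auto)
  also have "\<dots> = (\<Sum>i<k. left_coeff k p * of_bool (r = i) * Y $$ (i, s)
      - of_bool (odd p) * of_bool (s = i) * Y $$ (r, i)
      + of_bool (even p) * of_bool (i = i) * Y $$ (r, s) - trace_coeff k p * of_bool (r = s) * Y $$ (i, i))"
    using Y rs by (intro sum.cong refl sl_path_sum_act_entry) auto
  also have "\<dots> = casimir_scalar p k * Y $$ (r, s)"
    unfolding sum_subtractf sum.distrib sum_delta_mult(2)[OF rs(1)] sum_delta_mult(2)[OF rs(2)]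
      sum_distrib_left[symmetric] trace
    by (simp add: casimir_scalar_def algebra_simps)
  finally show "sl_act k (casimir_poly p k) Y $$ (r, s) = (casimir_scalar p k \<cdot>\<^sub>m Y) $$ (r, s)"
    using Y' rs by simp
qed

lemma casimir_action:
  fixes Y :: "'f::field_char_0 mat"
  assumes "p \<noteq> 0" "Y \<in> carrier (sl k)"
  shows "env_action (sl k) (adjoint (sl k)) (casimir p k) Y = casimir_scalar p k \<odot>\<^bsub>sl k\<^esub> Y"
  unfolding casimir_eq_coset[OF assms(1)] ad.env_action_coset[OF casimir_poly_closed assms(2)]
    casimir_poly_act[OF assms(2)] sl_simps(5) ..

text \<open>The scalar is determined by its action on a single nonzero element, such as the matrix unit
\<open>e\<^sub>1\<^sub>2\<close>. For \<open>p = 1\<close> the conventional value \<open>0\<close> agrees with the general formula, which lets the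
recursion for the eigenvalue include the case \<open>p = 3\<close>.\<close>

lemma casimir_eigenvalue_eq:
  assumes "p \<noteq> 0" "k \<ge> 2"
  shows "(casimir_eigenvalue p k :: 'f::field_char_0) = casimir_scalar p k"
proof (cases "p = 1")
  case True
  then show ?thesis by (simp add: casimir_eigenvalue_def casimir_scalar_def)
next
  case False
  let ?E = "matrix_unit k 1 2 :: 'f mat"
  have E: "?E \<in> carrier (sl k)"
    by (auto simp: sl_simps matrix_unit_def intro!: sum.neutral)
  have "adjoint_character (sl k) (casimir p k) = (casimir_scalar p k :: 'f)"
    unfolding adjoint_character_def
  proof (rule the_equality)
    fix c :: 'f
    assume "\<forall>Y\<in>carrier (sl k). env_action (sl k) (adjoint (sl k)) (casimir p k) Y = c \<odot>\<^bsub>sl k\<^esub> Y"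
    then have "c \<cdot>\<^sub>m ?E = casimir_scalar p k \<cdot>\<^sub>m ?E"
      using E casimir_action[OF assms(1) E] by (simp add: sl_simps(5))
    then have "(c \<cdot>\<^sub>m ?E) $$ (0, 1) = (casimir_scalar p k \<cdot>\<^sub>m ?E) $$ (0, 1)" by simp
    then show "c = casimir_scalar p k"
      using assms(2) by (simp add: matrix_unit_def)
  qed (use casimir_action[OF assms(1)] in blast)
  then show ?thesis using False by (simp add: casimir_eigenvalue_def)
qed

section \<open>Centrality of the Casimir elements\<close>

text \<open>For \<open>e\<^sub>i\<^sub>j\<close> in place of \<open>x\<^sub>i\<^sub>j\<close> this is a direct computation. Passing to \<open>x\<^sub>i\<^sub>j\<close> does not change the
bracket, and it changes both sums by \<open>Y\<^sub>j\<^sub>i / k\<close> times the identity matrix, which cancels. Entries of a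
matrix are numbered from \<open>0\<close>, whence the index shifts.\<close>

lemma bracket_sl_x:
  fixes Y :: "'f::field_char_0 mat"
  assumes Y: "Y \<in> carrier (sl k)" and i: "i \<in> {1..k}" and j: "j \<in> {1..k}"
  shows "Y \<otimes>\<^bsub>sl k\<^esub> sl_x k i j =
    (\<Oplus>\<^bsub>sl k\<^esub>a\<in>{1..k}. Y $$ (a - 1, i - 1) \<odot>\<^bsub>sl k\<^esub> sl_x k a j) \<oplus>\<^bsub>sl k\<^esub>
    (- 1) \<odot>\<^bsub>sl k\<^esub> (\<Oplus>\<^bsub>sl k\<^esub>b\<in>{1..k}. Y $$ (j - 1, b - 1) \<odot>\<^bsub>sl k\<^esub> sl_x k i b)"
    (is "_ = ?S \<oplus>\<^bsub>sl k\<^esub> (- 1) \<odot>\<^bsub>sl k\<^esub> ?S'")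
proof -
  obtain i' where i': "i = Suc i'" "i' < k" using i by (cases i) auto
  obtain j' where j': "j = Suc j'" "j' < k" using j by (cases j) auto
  have s: "Y $$ (a - 1, i - 1) \<odot>\<^bsub>sl k\<^esub> sl_x k a j \<in> carrier (sl k)"
    "Y $$ (j - 1, a - 1) \<odot>\<^bsub>sl k\<^esub> sl_x k i a \<in> carrier (sl k)" if "a \<in> {1..k}" for a
    using that i j by (auto intro!: ad.smult_closed sl_x_closed)
  then have "?S \<in> carrier (sl k)" "?S' \<in> carrier (sl k)"
    by (auto intro!: ad.V.finsum_closed)
  then have S: "?S \<in> carrier_mat k k" "?S' \<in> carrier_mat k k" by (auto simp: sl_simps)
  have x: "(sl_x k a b :: 'f mat) \<in> carrier_mat k k" if "a \<in> {1..k}" "b \<in> {1..k}" for a b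
    using sl_x_closed[OF that, where 'f='f] by (simp add: sl_simps)
  have entry: "(c \<odot>\<^bsub>sl k\<^esub> sl_x k (Suc a) (Suc b)) $$ (r, s) =
      c * (of_bool (r = a \<and> s = b) - of_bool (a = b \<and> r = s) / of_nat k)"
    if "a < k" "b < k" "r < k" "s < k" for c :: 'f and a b r s
    using that x[of "Suc a" "Suc b"] sl_x_entry[where 'f='f, OF that] by (simp add: sl_simps(5))
  have Y': "Y \<in> carrier_mat k k" using Y by (simp add: sl_simps)
  show ?thesis
  proof (rule eq_matI)
    fix r s
    assume "r < dim_row (?S \<oplus>\<^bsub>sl k\<^esub> (- 1) \<odot>\<^bsub>sl k\<^esub> ?S')" "s < dim_col (?S \<oplus>\<^bsub>sl k\<^esub> (- 1) \<odot>\<^bsub>sl k\<^esub> ?S')"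
    then have rs: "r < k" "s < k" using S by (auto simp: sl_simps)
    have "(Y \<otimes>\<^bsub>sl k\<^esub> sl_x k i j) $$ (r, s) = - adjoint (sl k) (sl_x k i j) Y $$ (r, s)"
      using Y' x[OF i j] rs by (simp add: adjoint_def sl_simps)
    also have "\<dots> = of_bool (s = j') * Y $$ (r, i') - of_bool (r = i') * Y $$ (j', s)"
      unfolding i' j' using i' j' rs Y by (subst adjoint_sl_x_entry) auto
    finally have lhs: "(Y \<otimes>\<^bsub>sl k\<^esub> sl_x k i j) $$ (r, s) = \<dots>" .
    have "?S $$ (r, s) = (\<Sum>a<k. (Y $$ (a, i') \<odot>\<^bsub>sl k\<^esub> sl_x k (Suc a) (Suc j')) $$ (r, s))"
      using s rs by (subst finsum_sl_entry) (auto simp: sum_one_to i' j' simp del: One_nat_def)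
    also have "\<dots> = (\<Sum>a<k. of_bool (s = j') * of_bool (r = a) * Y $$ (a, i') -
        of_bool (r = s) / of_nat k * of_bool (a = j') * Y $$ (a, i'))"
      using rs j' by (intro sum.cong refl) (auto simp: entry algebra_simps)
    also have "\<dots> = of_bool (s = j') * Y $$ (r, i') - of_bool (r = s) / of_nat k * Y $$ (j', i')"
      unfolding sum_subtractf sum_delta_mult(2)[OF rs(1)] sum_delta_mult(1)[OF j'(2)] ..
    finally have S_entry: "?S $$ (r, s) = \<dots>" .
    have "?S' $$ (r, s) = (\<Sum>b<k. (Y $$ (j', b) \<odot>\<^bsub>sl k\<^esub> sl_x k (Suc i') (Suc b)) $$ (r, s))"
      using s rs by (subst finsum_sl_entry) (auto simp: sum_one_to i' j' simp del: One_nat_def)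
    also have "\<dots> = (\<Sum>b<k. of_bool (r = i') * of_bool (s = b) * Y $$ (j', b) -
        of_bool (r = s) / of_nat k * of_bool (i' = b) * Y $$ (j', b))"
      using rs i' by (intro sum.cong refl) (auto simp: entry algebra_simps)
    also have "\<dots> = of_bool (r = i') * Y $$ (j', s) - of_bool (r = s) / of_nat k * Y $$ (j', i')"
      unfolding sum_subtractf sum_delta_mult(2)[OF rs(2)] sum_delta_mult(2)[OF i'(2)] ..
    finally have "?S' $$ (r, s) = \<dots>" .
    then show "(Y \<otimes>\<^bsub>sl k\<^esub> sl_x k i j) $$ (r, s) = (?S \<oplus>\<^bsub>sl k\<^esub> (- 1) \<odot>\<^bsub>sl k\<^esub> ?S') $$ (r, s)"
      using S rs lhs S_entry by (simp add: sl_simps)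
  qed (use S Y' x[OF i j] in \<open>auto simp: sl_simps\<close>)
qed

text \<open>The matrix identity \<open>bracket_sl_x\<close> read in the enveloping algebra.\<close>

lemma commutator_sl_gen:
  fixes Y :: "'f::field_char_0 mat"
  assumes Y: "Y \<in> carrier (sl k)" and i: "i \<in> {1..k}" and j: "j \<in> {1..k}"
  shows "gen Y * sl_gen k i j - sl_gen k i j * gen Y -
    ((\<Sum>a\<in>{1..k}. const (Y $$ (a - 1, i - 1)) * sl_gen k a j) -
     (\<Sum>b\<in>{1..k}. const (Y $$ (j - 1, b - 1)) * sl_gen k i b)) \<in> env_ideal (sl k)"
proof -
  have I: "ideal (env_ideal (sl k :: ('f, 'f mat) module)) (free_algebra (carrier (sl k)))"
    by (intro ideal_env_ideal sl_closed)
  note closed = free_algebra_ideal_closed[OF I]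
  have ab: "abelian_monoid (sl k :: ('f, 'f mat) module)"
    using abelian_group_sl abelian_group_def by blast
  let ?S = "\<Oplus>\<^bsub>sl k\<^esub>a\<in>{1..k}. Y $$ (a - 1, i - 1) \<odot>\<^bsub>sl k\<^esub> sl_x k a j"
  let ?S' = "\<Oplus>\<^bsub>sl k\<^esub>b\<in>{1..k}. Y $$ (j - 1, b - 1) \<odot>\<^bsub>sl k\<^esub> sl_x k i b"
  let ?T = "\<Sum>a\<in>{1..k}. const (Y $$ (a - 1, i - 1)) * sl_gen k a j"
  let ?T' = "\<Sum>b\<in>{1..k}. const (Y $$ (j - 1, b - 1)) * sl_gen k i b"
  have S: "?S \<in> carrier (sl k)" "?S' \<in> carrier (sl k)"
    using i j by (auto intro!: ad.V.finsum_closed ad.smult_closed sl_x_closed)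
  have neg: "const (- 1) = (- 1 :: 'f mat list \<Rightarrow>\<^sub>0 'f)"
    by (simp add: const_def single_uminus flip: zero_list_def)
  have bracket: "gen Y * sl_gen k i j - sl_gen k i j * gen Y - gen (Y \<otimes>\<^bsub>sl k\<^esub> sl_x k i j) \<in> env_ideal (sl k)"
    by (rule env_ideal_relations(3)[OF Y sl_x_closed[OF i j]])
  have add: "gen (Y \<otimes>\<^bsub>sl k\<^esub> sl_x k i j) - (gen ?S + gen ((- 1) \<odot>\<^bsub>sl k\<^esub> ?S')) \<in> env_ideal (sl k)"
    unfolding bracket_sl_x[OF Y i j]
    by (rule env_ideal_relations(2)[OF S(1) ad.smult_closed[OF S(2)]])
  have "gen ((- 1) \<odot>\<^bsub>sl k\<^esub> ?S') - const (- 1) * gen ?S' \<in> env_ideal (sl k)"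
    by (rule env_ideal_relations(1)[OF S(2)])
  then have scale: "gen ((- 1) \<odot>\<^bsub>sl k\<^esub> ?S') + gen ?S' \<in> env_ideal (sl k)"
    by (simp add: neg)
  have "gen ?S - ?T \<in> env_ideal (sl k)" "gen ?S' - ?T' \<in> env_ideal (sl k)"
    using i j by (auto intro!: gen_finsum I ab sl_closed sl_x_closed)
  note lin = this(1) closed(3)[OF this(2), of "- 1"]
  have "(gen Y * sl_gen k i j - sl_gen k i j * gen Y - gen (Y \<otimes>\<^bsub>sl k\<^esub> sl_x k i j)) +
      ((gen (Y \<otimes>\<^bsub>sl k\<^esub> sl_x k i j) - (gen ?S + gen ((- 1) \<odot>\<^bsub>sl k\<^esub> ?S'))) +
      ((gen ((- 1) \<odot>\<^bsub>sl k\<^esub> ?S') + gen ?S') + ((gen ?S - ?T) + (gen ?S' - ?T') * (- 1)))) \<in> env_ideal (sl k)"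
    by (intro closed(2) bracket add scale lin) (simp add: zero_list_def)
  moreover have "(gen Y * sl_gen k i j - sl_gen k i j * gen Y - gen (Y \<otimes>\<^bsub>sl k\<^esub> sl_x k i j)) +
      ((gen (Y \<otimes>\<^bsub>sl k\<^esub> sl_x k i j) - (gen ?S + gen ((- 1) \<odot>\<^bsub>sl k\<^esub> ?S'))) +
      ((gen ((- 1) \<odot>\<^bsub>sl k\<^esub> ?S') + gen ?S') + ((gen ?S - ?T) + (gen ?S' - ?T') * (- 1)))) =
    gen Y * sl_gen k i j - sl_gen k i j * gen Y - (?T - ?T')"
    by simp
  ultimately show ?thesis by (simp only:)
qed

lemma casimir_central:
  assumes "p \<noteq> 0"
  shows "(casimir p k :: ('f::field_char_0 mat list \<Rightarrow>\<^sub>0 'f) set) \<in> ring_center (univ_env (sl k))"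
proof -
  have I: "ideal (env_ideal (sl k :: ('f, 'f mat) module)) (free_algebra (carrier (sl k)))"
    by (intro ideal_env_ideal sl_closed)
  show ?thesis
    unfolding casimir_eq_coset[OF assms] univ_env_def
  proof (rule coset_in_ring_center[OF I casimir_poly_closed])
    fix Y :: "'f mat" assume Y: "Y \<in> carrier (sl k)"
    show "gen Y * casimir_poly p k - casimir_poly p k * gen Y \<in> env_ideal (sl k)"
      unfolding casimir_poly_def
      by (rule commutator_trace_path_sum[OF I, where m = "\<lambda>a i. const (Y $$ (a - 1, i - 1))"])
        (intro finite_atLeastAtMost sl_gen_closed const_central commutator_sl_gen Y | assumption)+
  qed
qed

section \<open>The eigenvalues in closed form\<close>

text \<open>Since \<open>a\<^sub>p\<^sub>+\<^sub>1 = k a\<^sub>p + [p even]\<close> has an inhomogeneous part of period \<open>2\<close>, the difference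
\<open>a\<^sub>p\<^sub>+\<^sub>2 - a\<^sub>p\<close> is multiplied by \<open>k\<close> at each step.\<close>

lemma left_coeff_add_2: "left_coeff k (p + 2) = left_coeff k p + of_nat k ^ (p + 1)"
  by (induction p) (simp_all add: algebra_simps)

lemma casimir_scalar_add_2: "casimir_scalar (p + 2) k = casimir_scalar p k + of_nat k ^ (p + 1)"
  unfolding casimir_scalar_def left_coeff_add_2 by simp

lemma left_coeff_closed_form:
  assumes "k \<ge> 2"
  shows "left_coeff k (2 * n) = (of_nat k * ((of_nat k ^ (2 * n) - 1) / (of_nat k ^ 2 - 1)) :: 'f::field_char_0)"
    "left_coeff k (2 * n + 1) = (of_nat k ^ 2 * ((of_nat k ^ (2 * n) - 1) / (of_nat k ^ 2 - 1)) + 1 :: 'f)"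
proof -
  have "k ^ 2 \<noteq> 1" using assms by simp
  then have "(of_nat (k ^ 2) :: 'f) \<noteq> 1" using of_nat_eq_1_iff by blast
  then have k: "(of_nat k ^ 2 - 1 :: 'f) \<noteq> 0" by simp
  show even: "left_coeff k (2 * n) = (of_nat k * ((of_nat k ^ (2 * n) - 1) / (of_nat k ^ 2 - 1)) :: 'f)"
  proof (induction n)
    case (Suc n)
    have "left_coeff k (2 * Suc n) = (left_coeff k (2 * n) + of_nat k ^ (2 * n + 1) :: 'f)"
      using left_coeff_add_2[of k "2 * n"] by (simp add: add.commute)
    then show ?case
      unfolding Suc.IH using k by (simp add: field_simps power_add power2_eq_square)
  qed simp
  show "left_coeff k (2 * n + 1) = (of_nat k ^ 2 * ((of_nat k ^ (2 * n) - 1) / (of_nat k ^ 2 - 1)) + 1 :: 'f)"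
    by (simp add: even power2_eq_square)
qed

theorem lemma3p4p4:
  fixes k :: nat
  assumes "k \<ge> 2"
  shows "(\<forall>p\<in>{2..k}.
            (casimir p k :: ('f::field_char_0 mat list \<Rightarrow>\<^sub>0 'f) set) \<in> ring_center (univ_env (sl k)) \<and>
            (\<forall>y\<in>carrier (sl k).
               env_action (sl k) (adjoint (sl k)) (casimir p k) y =
                 (casimir_eigenvalue p k :: 'f) \<odot>\<^bsub>sl k\<^esub> y)) \<and>
         (casimir_eigenvalue 2 k :: 'f) = 2 * of_nat k \<and>
         (\<forall>p\<in>{3..k}. (casimir_eigenvalue p k :: 'f) =
            casimir_eigenvalue (p - 2) k + of_nat k ^ (p - 1)) \<and>
         (\<forall>p\<in>{2..k}. (casimir_eigenvalue p k :: 'f) =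
            (if even p then of_nat k * ((of_nat k ^ p - 1) / (of_nat k ^ 2 - 1) + 1)
             else of_nat k ^ 2 * ((of_nat k ^ (p - 1) - 1) / (of_nat k ^ 2 - 1))))"
proof (intro conjI ballI)
  fix p assume p: "p \<in> {2..k}"
  then have "p \<noteq> 0" by auto
  then show "(casimir p k :: ('f mat list \<Rightarrow>\<^sub>0 'f) set) \<in> ring_center (univ_env (sl k))"
    by (rule casimir_central)
  fix y :: "'f mat" assume "y \<in> carrier (sl k)"
  then show "env_action (sl k) (adjoint (sl k)) (casimir p k) y =
      (casimir_eigenvalue p k :: 'f) \<odot>\<^bsub>sl k\<^esub> y"
    using \<open>p \<noteq> 0\<close> assms by (simp add: casimir_action casimir_eigenvalue_eq)
next
  show "(casimir_eigenvalue 2 k :: 'f) = 2 * of_nat k"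
    using assms by (simp add: casimir_eigenvalue_eq casimir_scalar_def numeral_2_eq_2)
next
  fix p assume p: "p \<in> {3..k}"
  then have "p = (p - 2) + 2" "p - 1 = (p - 2) + 1" by auto
  then have "casimir_scalar p k = (casimir_scalar (p - 2) k + of_nat k ^ (p - 1) :: 'f)"
    using casimir_scalar_add_2[of "p - 2" k] by metis
  then show "(casimir_eigenvalue p k :: 'f) = casimir_eigenvalue (p - 2) k + of_nat k ^ (p - 1)"
    using p assms by (simp add: casimir_eigenvalue_eq)
next
  fix p assume p: "p \<in> {2..k}"
  have "(casimir_scalar p k :: 'f) =
      (if even p then of_nat k * ((of_nat k ^ p - 1) / (of_nat k ^ 2 - 1) + 1)
       else of_nat k ^ 2 * ((of_nat k ^ (p - 1) - 1) / (of_nat k ^ 2 - 1)))"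
  proof (cases "even p")
    case True
    then obtain n where "p = 2 * n" by blast
    then show ?thesis
      by (simp add: casimir_scalar_def left_coeff_closed_form(1)[OF assms] distrib_left)
  next
    case False
    then obtain n where "p = 2 * n + 1" using oddE by blast
    then show ?thesis
      using left_coeff_closed_form(2)[OF assms, of n, where 'f='f] by (simp add: casimir_scalar_def)
  qed
  then show "(casimir_eigenvalue p k :: 'f) =
      (if even p then of_nat k * ((of_nat k ^ p - 1) / (of_nat k ^ 2 - 1) + 1)
       else of_nat k ^ 2 * ((of_nat k ^ (p - 1) - 1) / (of_nat k ^ 2 - 1)))"
    using p assms by (simp add: casimir_eigenvalue_eq)
qed

end
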